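(* Let $n\ge 1$ and let $\varepsilon=(\varepsilon_{ij})_{i,j\in\{1,\dots,n\}}$ be a symmetric matrix with $\varepsilon_{ij}\in\{0,1\}$ and $\varepsilon_{ii}=0$. Then $\mathring{O}_n^{\varepsilon}$ is the quantum symmetry group of $\mathbb{X}_n^{\varepsilon}$, in the following sense: (i) $\mathring{O}_n^{\varepsilon}$ acts on $\mathbb{X}_n^{\varepsilon}$ by (well-defined) unital $*$-homomorphisms $$\alpha,\beta:C(\mathbb{X}_n^{\varepsilon})\to C(\mathring{O}_n^{\varepsilon})\otimes C(\mathbb{X}_n^{\varepsilon}),\qquad \alpha(x_{ik})=\sum_j u_{ij}\otimes x_{jk},\quad \beta(x_{ik})=\sum_j u_{ji}\otimes x_{jk};$$ (ii) for any compact matrix quantum group $\mathbb{G}$ with $n\times n$ generating matrix $(u_{ij})$ acting on $\mathbb{X}_n^{\varepsilon}$ in the same way (i.e. such that there are unital $*$-homomorphisms $\alpha',\beta':C(\mathbb{X}_n^{\varepsilon})\to C(\mathbb{G})\otimes C(\mathbb{X}_n^{\varepsilon})$ with $\alpha'(x_{ik})=\sum_j u_{ij}\otimes x_{jk}$ and $\beta'(x_{ik})=\sum_j u_{ji}\otimes x_{jk}$), $\mathbb{G}$ is a compact matrix quantum subgroup of $\mathring{O}_n^{\varepsilon}$.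
   Context: $C(\mathring{O}_n^{\varepsilon})$ is the universal unital C*-algebra generated by elements $u_{ij}$, $1\le i,j\le n$, subject to: $u_{ij}=u_{ij}^*$; the matrix $u=(u_{ij})$ is orthogonal, i.e. $\sum_k u_{ik}u_{jk}=\sum_k u_{ki}u_{kj}=\delta_{ij}$; and, for all $i,j,k,l$, - $u_{ik}u_{jl}=u_{jl}u_{ik}$ if $\varepsilon_{ij}=1$ and $\varepsilon_{kl}=1$; - $u_{ik}u_{jl}=0$ if $\varepsilon_{ij}=1$ and $\varepsilon_{kl}=0$; - $u_{ik}u_{jl}=0$ if $\varepsilon_{ij}=0$ and $\varepsilon_{kl}=1$. With the comultiplication $\Delta(u_{ij})=\sum_k u_{ik}\otimes u_{kj}$, $\mathring{O}_n^{\varepsilon}$ is a compact matrix quantum group. $C(\mathbb{X}_n^{\varepsilon})$ is the universal unital C*-algebra generated by elements $x_{ij}$, $1\le i,j\le n$, subject to: $x_{ij}=x_{ij}^*$; $\sum_i x_{ik}x_{il}=\delta_{kl}$ for all $k,l$; and, for all $i,j,k,l$, - $x_{ik}x_{jl}=x_{jl}x_{ik}$ if $\varepsilon_{ij}=1$ and $\varepsilon_{kl}=1$; - $x_{ik}x_{jl}=0$ if $\varepsilon_{ij}=1$ and $\varepsilon_{kl}=0$; - $x_{ik}x_{jl}=0$ if $\varepsilon_{ij}=0$ and $\varepsilon_{kl}=1$. A compact matrix quantum group $\mathbb{G}$ (Woronowicz) is given by a unital C*-algebra $C(\mathbb{G})$ together with a matrix $u=(u_{ij})\in M_n(C(\mathbb{G}))$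 such that the $u_{ij}$ generate $C(\mathbb{G})$ as a C*-algebra, $u$ and $\bar u=(u_{ij}^* )$ are invertible, and there is a unital $*$-homomorphism $\Delta:C(\mathbb{G})\to C(\mathbb{G})\otimes C(\mathbb{G})$ with $\Delta(u_{ij})=\sum_k u_{ik}\otimes u_{kj}$. Tensor products are minimal C*-tensor products. A compact matrix quantum group $\mathbb{G}$ with $n\times n$ generating matrix $(u_{ij}^{\mathbb{G}})$ is a compact matrix quantum subgroup of $\mathbb{H}$ with $n\times n$ generating matrix $(u_{ij}^{\mathbb{H}})$ if there is a (surjective) unital $*$-homomorphism $C(\mathbb{H})\to C(\mathbb{G})$ with $u_{ij}^{\mathbb{H}}\mapsto u_{ij}^{\mathbb{G}}$ for all $i,j$. *)

theory Defs
  imports "HOL-Analysis.Analysis" "HOL-Algebra.Module" "HOL-Algebra.Algebraic_Closure_Type"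
begin

section \<open>Unital C*-algebras\<close>

record 'a cstar = "(complex, 'a) module" +
  star :: "'a \<Rightarrow> 'a"
  cnorm :: "'a \<Rightarrow> real"

text \<open>The zero algebra is not excluded. Completeness is stated with sequences, as
  the distance \<open>\<lambda>x y. cnorm A (x \<ominus> y)\<close> is only controlled on the carrier.\<close>

locale unital_cstar_algebra =
  module "ring_of_type_algebra :: complex ring" A + ring A for A :: "'a cstar" (structure) +
  assumes smult_mult_left: "\<And>c x y. \<lbrakk>x \<in> carrier A; y \<in> carrier A\<rbrakk>
      \<Longrightarrow> (c \<odot> x) \<otimes> y = c \<odot> (x \<otimes> y)"
    and smult_mult_right: "\<And>c x y. \<lbrakk>x \<in> carrier A; y \<in> carrier A\<rbrakk>
      \<Longrightarrow> x \<otimes> (c \<odot> y) = c \<odot> (x \<otimes> y)"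
    and star_closed: "\<And>x. x \<in> carrier A \<Longrightarrow> star A x \<in> carrier A"
    and star_star: "\<And>x. x \<in> carrier A \<Longrightarrow> star A (star A x) = x"
    and star_add: "\<And>x y. \<lbrakk>x \<in> carrier A; y \<in> carrier A\<rbrakk>
      \<Longrightarrow> star A (x \<oplus> y) = star A x \<oplus> star A y"
    and star_smult: "\<And>c x. x \<in> carrier A \<Longrightarrow> star A (c \<odot> x) = cnj c \<odot> star A x"
    and star_mult: "\<And>x y. \<lbrakk>x \<in> carrier A; y \<in> carrier A\<rbrakk>
      \<Longrightarrow> star A (x \<otimes> y) = star A y \<otimes> star A x"
    and cnorm_nonneg: "\<And>x. x \<in> carrier A \<Longrightarrow> 0 \<le> cnorm A x"
    and cnorm_eq_0_iff: "\<And>x. x \<in> carrier A \<Longrightarrow> cnorm A x = 0 \<longleftrightarrow> x = \<zero>"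
    and cnorm_smult: "\<And>c x. x \<in> carrier A \<Longrightarrow> cnorm A (c \<odot> x) = cmod c * cnorm A x"
    and cnorm_triangle: "\<And>x y. \<lbrakk>x \<in> carrier A; y \<in> carrier A\<rbrakk>
      \<Longrightarrow> cnorm A (x \<oplus> y) \<le> cnorm A x + cnorm A y"
    and cnorm_mult: "\<And>x y. \<lbrakk>x \<in> carrier A; y \<in> carrier A\<rbrakk>
      \<Longrightarrow> cnorm A (x \<otimes> y) \<le> cnorm A x * cnorm A y"
    and cstar_identity: "\<And>x. x \<in> carrier A \<Longrightarrow> cnorm A (star A x \<otimes> x) = (cnorm A x)\<^sup>2"
    and complete: "\<And>s :: nat \<Rightarrow> 'a. \<lbrakk>range s \<subseteq> carrier A;
        \<And>e. e > 0 \<Longrightarrow> \<exists>N. \<forall>k\<ge>N. \<forall>l\<ge>N. cnorm A (s k \<ominus> s l) < e\<rbrakk>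
      \<Longrightarrow> \<exists>x\<in>carrier A. (\<lambda>k. cnorm A (s k \<ominus> x)) \<longlonglongrightarrow> 0"

definition norm_closed :: "'a cstar \<Rightarrow> 'a set \<Rightarrow> bool" where
  "norm_closed A S \<longleftrightarrow> (\<forall>s x. range s \<subseteq> S \<longrightarrow> x \<in> carrier A \<longrightarrow>
     (\<lambda>k::nat. cnorm A (s k \<ominus>\<^bsub>A\<^esub> x)) \<longlonglongrightarrow> 0 \<longrightarrow> x \<in> S)"

definition lin_subspace :: "'a cstar \<Rightarrow> 'a set \<Rightarrow> bool" where
  "lin_subspace A S \<longleftrightarrow> S \<subseteq> carrier A \<and> \<zero>\<^bsub>A\<^esub> \<in> S \<and>
     (\<forall>x\<in>S. \<forall>y\<in>S. x \<oplus>\<^bsub>A\<^esub> y \<in> S) \<and> (\<forall>c. \<forall>x\<in>S. c \<odot>\<^bsub>A\<^esub> x \<in> S)"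

definition unital_cstar_subalgebra :: "'a cstar \<Rightarrow> 'a set \<Rightarrow> bool" where
  "unital_cstar_subalgebra A S \<longleftrightarrow> lin_subspace A S \<and> norm_closed A S \<and> \<one>\<^bsub>A\<^esub> \<in> S \<and>
     (\<forall>x\<in>S. \<forall>y\<in>S. x \<otimes>\<^bsub>A\<^esub> y \<in> S) \<and> (\<forall>x\<in>S. star A x \<in> S)"

definition cstar_generates :: "'a cstar \<Rightarrow> 'a set \<Rightarrow> bool" where
  "cstar_generates A G \<longleftrightarrow> G \<subseteq> carrier A \<and>
     (\<forall>S. unital_cstar_subalgebra A S \<longrightarrow> G \<subseteq> S \<longrightarrow> S = carrier A)"

definition unital_star_hom :: "'a cstar \<Rightarrow> 'b cstar \<Rightarrow> ('a \<Rightarrow> 'b) set" where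
  "unital_star_hom A B = {h \<in> ring_hom A B.
     (\<forall>c. \<forall>x\<in>carrier A. h (c \<odot>\<^bsub>A\<^esub> x) = c \<odot>\<^bsub>B\<^esub> h x) \<and>
     (\<forall>x\<in>carrier A. h (star A x) = star B (h x))}"


section \<open>Representations and the minimal tensor product\<close>

text \<open>Every Hilbert space is unitarily equivalent to \<open>\<ell>\<^sup>2(I)\<close> for some index set; operators
  are functions on \<^typ>\<open>'i \<Rightarrow> complex\<close> of which only the restriction to \<open>ell2\<close> matters.\<close>

definition ell2 :: "('i \<Rightarrow> complex) set" where
  "ell2 = {f. (\<lambda>i. (cmod (f i))\<^sup>2) summable_on UNIV}"

definition ell2_inner :: "('i \<Rightarrow> complex) \<Rightarrow> ('i \<Rightarrow> complex) \<Rightarrow> complex" where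
  "ell2_inner f g = (\<Sum>\<^sub>\<infinity>i. cnj (f i) * g i)"

definition ell2_norm :: "('i \<Rightarrow> complex) \<Rightarrow> real" where
  "ell2_norm f = sqrt (\<Sum>\<^sub>\<infinity>i. (cmod (f i))\<^sup>2)"

definition bounded_operator :: "(('i \<Rightarrow> complex) \<Rightarrow> ('i \<Rightarrow> complex)) \<Rightarrow> bool" where
  "bounded_operator F \<longleftrightarrow>
     (\<forall>f\<in>ell2. F f \<in> ell2) \<and>
     (\<forall>f\<in>ell2. \<forall>g\<in>ell2. F (\<lambda>i. f i + g i) = (\<lambda>i. F f i + F g i)) \<and>
     (\<forall>c. \<forall>f\<in>ell2. F (\<lambda>i. c * f i) = (\<lambda>i. c * F f i)) \<and>
     (\<exists>C. \<forall>f\<in>ell2. ell2_norm (F f) \<le> C * ell2_norm f)"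

definition operator_norm :: "(('i \<Rightarrow> complex) \<Rightarrow> ('i \<Rightarrow> complex)) \<Rightarrow> real" where
  "operator_norm F = (SUP f\<in>{f \<in> ell2. ell2_norm f \<le> 1}. ell2_norm (F f))"

text \<open>A representation is a *-homomorphism into \<open>B(\<ell>\<^sup>2(I))\<close>; it may be degenerate.\<close>

definition representation ::
  "'a cstar \<Rightarrow> ('a \<Rightarrow> ('i \<Rightarrow> complex) \<Rightarrow> ('i \<Rightarrow> complex)) \<Rightarrow> bool" where
  "representation A \<pi> \<longleftrightarrow>
     (\<forall>a\<in>carrier A. bounded_operator (\<pi> a)) \<and>
     (\<forall>a\<in>carrier A. \<forall>b\<in>carrier A. \<forall>f\<in>ell2. \<pi> (a \<oplus>\<^bsub>A\<^esub> b) f = (\<lambda>i. \<pi> a f i + \<pi> b f i)) \<and>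
     (\<forall>c. \<forall>a\<in>carrier A. \<forall>f\<in>ell2. \<pi> (c \<odot>\<^bsub>A\<^esub> a) f = (\<lambda>i. c * \<pi> a f i)) \<and>
     (\<forall>a\<in>carrier A. \<forall>b\<in>carrier A. \<forall>f\<in>ell2. \<pi> (a \<otimes>\<^bsub>A\<^esub> b) f = \<pi> a (\<pi> b f)) \<and>
     (\<forall>a\<in>carrier A. \<forall>f\<in>ell2. \<forall>g\<in>ell2.
        ell2_inner f (\<pi> (star A a) g) = ell2_inner (\<pi> a f) g)"

definition faithful_representation ::
  "'a cstar \<Rightarrow> ('a \<Rightarrow> ('i \<Rightarrow> complex) \<Rightarrow> ('i \<Rightarrow> complex)) \<Rightarrow> bool" where
  "faithful_representation A \<pi> \<longleftrightarrow> representation A \<pi> \<and>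
     (\<forall>a\<in>carrier A. (\<forall>f\<in>ell2. \<pi> a f = (\<lambda>_. 0)) \<longrightarrow> a = \<zero>\<^bsub>A\<^esub>)"

definition tensor_vec :: "('i \<Rightarrow> complex) \<Rightarrow> ('j \<Rightarrow> complex) \<Rightarrow> ('i \<times> 'j \<Rightarrow> complex)" where
  "tensor_vec f g = (\<lambda>(i, j). f i * g j)"

text \<open>\<open>T\<close> together with the map \<open>(a, b) \<mapsto> tens a b\<close> is (a model of) the minimal tensor product of
  \<open>A\<close> and \<open>B\<close>: for faithful representations \<open>\<pi>\<close> on \<open>H\<close> and \<open>\<rho>\<close> on \<open>K\<close>, it is carried
  isometrically by \<open>\<sigma>\<close> onto the closed linear span of the operators
  \<open>\<pi> a \<otimes> \<rho> b\<close> on \<open>H \<otimes> K\<close>. The choice of \<open>\<pi>\<close> and \<open>\<rho>\<close> is immaterial up to isomorphism. Every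
  C*-algebra with carrier in a type \<open>'a\<close> has a faithful representation on \<open>\<ell>\<^sup>2('a)\<close>:
  in the Gelfand--Naimark construction, one cyclic representation for each element suffices,
  and each of them has Hilbert dimension at most the cardinality of the carrier.\<close>

definition min_tensor_product ::
  "'a cstar \<Rightarrow> 'b cstar \<Rightarrow> 't cstar \<Rightarrow> ('a \<Rightarrow> 'b \<Rightarrow> 't) \<Rightarrow> bool" where
  "min_tensor_product A B T tens \<longleftrightarrow>
     unital_cstar_algebra A \<and> unital_cstar_algebra B \<and> unital_cstar_algebra T \<and>
     (\<forall>a\<in>carrier A. \<forall>b\<in>carrier B. tens a b \<in> carrier T) \<and>
     (\<forall>S. lin_subspace T S \<longrightarrow> norm_closed T S \<longrightarrow>
        (\<forall>a\<in>carrier A. \<forall>b\<in>carrier B. tens a b \<in> S) \<longrightarrow> S = carrier T) \<and>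
     (\<exists>(\<pi> :: 'a \<Rightarrow> ('a \<Rightarrow> complex) \<Rightarrow> ('a \<Rightarrow> complex))
        (\<rho> :: 'b \<Rightarrow> ('b \<Rightarrow> complex) \<Rightarrow> ('b \<Rightarrow> complex))
        (\<sigma> :: 't \<Rightarrow> ('a \<times> 'b \<Rightarrow> complex) \<Rightarrow> ('a \<times> 'b \<Rightarrow> complex)).
        faithful_representation A \<pi> \<and> faithful_representation B \<rho> \<and> representation T \<sigma> \<and>
        (\<forall>t\<in>carrier T. cnorm T t = operator_norm (\<sigma> t)) \<and>
        (\<forall>a\<in>carrier A. \<forall>b\<in>carrier B. \<forall>f\<in>ell2. \<forall>g\<in>ell2.
           \<sigma> (tens a b) (tensor_vec f g) = tensor_vec (\<pi> a f) (\<rho> b g)))"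


section \<open>Compact matrix quantum groups\<close>

text \<open>Matrices have indices in \<open>{1..n}\<close>; values of \<open>u i j\<close> outside this range are irrelevant.\<close>

definition delta :: "'a cstar \<Rightarrow> nat \<Rightarrow> nat \<Rightarrow> 'a" where
  "delta A i j = (if i = j then \<one>\<^bsub>A\<^esub> else \<zero>\<^bsub>A\<^esub>)"

definition matrix_over :: "nat \<Rightarrow> 'a cstar \<Rightarrow> (nat \<Rightarrow> nat \<Rightarrow> 'a) \<Rightarrow> bool" where
  "matrix_over n A u \<longleftrightarrow> (\<forall>i\<in>{1..n}. \<forall>j\<in>{1..n}. u i j \<in> carrier A)"

definition entries :: "nat \<Rightarrow> (nat \<Rightarrow> nat \<Rightarrow> 'a) \<Rightarrow> 'a set" where
  "entries n u = {u i j | i j. i \<in> {1..n} \<and> j \<in> {1..n}}"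

definition matrix_invertible :: "nat \<Rightarrow> 'a cstar \<Rightarrow> (nat \<Rightarrow> nat \<Rightarrow> 'a) \<Rightarrow> bool" where
  "matrix_invertible n A u \<longleftrightarrow> (\<exists>v. matrix_over n A v \<and>
     (\<forall>i\<in>{1..n}. \<forall>j\<in>{1..n}.
        (\<Oplus>\<^bsub>A\<^esub>k\<in>{1..n}. u i k \<otimes>\<^bsub>A\<^esub> v k j) = delta A i j \<and>
        (\<Oplus>\<^bsub>A\<^esub>k\<in>{1..n}. v i k \<otimes>\<^bsub>A\<^esub> u k j) = delta A i j))"

text \<open>The arguments \<open>T\<close> and \<open>tens\<close> supply the minimal tensor product of \<open>A\<close> with itself.\<close>

definition compact_matrix_quantum_group ::
  "nat \<Rightarrow> 'a cstar \<Rightarrow> (nat \<Rightarrow> nat \<Rightarrow> 'a) \<Rightarrow> 't cstar \<Rightarrow> ('a \<Rightarrow> 'a \<Rightarrow> 't) \<Rightarrow> bool" where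
  "compact_matrix_quantum_group n A u T tens \<longleftrightarrow>
     unital_cstar_algebra A \<and> min_tensor_product A A T tens \<and>
     matrix_over n A u \<and> cstar_generates A (entries n u) \<and>
     matrix_invertible n A u \<and> matrix_invertible n A (\<lambda>i j. star A (u i j)) \<and>
     (\<exists>\<Delta> \<in> unital_star_hom A T. \<forall>i\<in>{1..n}. \<forall>j\<in>{1..n}.
        \<Delta> (u i j) = (\<Oplus>\<^bsub>T\<^esub>k\<in>{1..n}. tens (u i k) (u k j)))"

definition quantum_subgroup ::
  "nat \<Rightarrow> 'g cstar \<Rightarrow> (nat \<Rightarrow> nat \<Rightarrow> 'g) \<Rightarrow> 's cstar \<Rightarrow> ('g \<Rightarrow> 'g \<Rightarrow> 's) \<Rightarrow>
   'h cstar \<Rightarrow> (nat \<Rightarrow> nat \<Rightarrow> 'h) \<Rightarrow> 't cstar \<Rightarrow> ('h \<Rightarrow> 'h \<Rightarrow> 't) \<Rightarrow> bool" where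
  "quantum_subgroup n G v TG tG H u TH tH \<longleftrightarrow>
     compact_matrix_quantum_group n G v TG tG \<and> compact_matrix_quantum_group n H u TH tH \<and>
     (\<exists>\<phi> \<in> unital_star_hom H G. \<phi> ` carrier H = carrier G \<and>
        (\<forall>i\<in>{1..n}. \<forall>j\<in>{1..n}. \<phi> (u i j) = v i j))"


section \<open>The universal C*-algebras\<close>

definition eps_relations ::
  "nat \<Rightarrow> (nat \<Rightarrow> nat \<Rightarrow> nat) \<Rightarrow> 'a cstar \<Rightarrow> (nat \<Rightarrow> nat \<Rightarrow> 'a) \<Rightarrow> bool" where
  "eps_relations n \<epsilon> A u \<longleftrightarrow>
     (\<forall>i\<in>{1..n}. \<forall>j\<in>{1..n}. \<forall>k\<in>{1..n}. \<forall>l\<in>{1..n}.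
        (\<epsilon> i j = 1 \<and> \<epsilon> k l = 1 \<longrightarrow> u i k \<otimes>\<^bsub>A\<^esub> u j l = u j l \<otimes>\<^bsub>A\<^esub> u i k) \<and>
        (\<epsilon> i j = 1 \<and> \<epsilon> k l = 0 \<longrightarrow> u i k \<otimes>\<^bsub>A\<^esub> u j l = \<zero>\<^bsub>A\<^esub>) \<and>
        (\<epsilon> i j = 0 \<and> \<epsilon> k l = 1 \<longrightarrow> u i k \<otimes>\<^bsub>A\<^esub> u j l = \<zero>\<^bsub>A\<^esub>))"

definition O_relations ::
  "nat \<Rightarrow> (nat \<Rightarrow> nat \<Rightarrow> nat) \<Rightarrow> 'a cstar \<Rightarrow> (nat \<Rightarrow> nat \<Rightarrow> 'a) \<Rightarrow> bool" where
  "O_relations n \<epsilon> A u \<longleftrightarrow>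
     matrix_over n A u \<and>
     (\<forall>i\<in>{1..n}. \<forall>j\<in>{1..n}. star A (u i j) = u i j) \<and>
     (\<forall>i\<in>{1..n}. \<forall>j\<in>{1..n}.
        (\<Oplus>\<^bsub>A\<^esub>k\<in>{1..n}. u i k \<otimes>\<^bsub>A\<^esub> u j k) = delta A i j \<and>
        (\<Oplus>\<^bsub>A\<^esub>k\<in>{1..n}. u k i \<otimes>\<^bsub>A\<^esub> u k j) = delta A i j) \<and>
     eps_relations n \<epsilon> A u"

definition X_relations ::
  "nat \<Rightarrow> (nat \<Rightarrow> nat \<Rightarrow> nat) \<Rightarrow> 'a cstar \<Rightarrow> (nat \<Rightarrow> nat \<Rightarrow> 'a) \<Rightarrow> bool" where
  "X_relations n \<epsilon> A x \<longleftrightarrow>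
     matrix_over n A x \<and>
     (\<forall>i\<in>{1..n}. \<forall>j\<in>{1..n}. star A (x i j) = x i j) \<and>
     (\<forall>k\<in>{1..n}. \<forall>l\<in>{1..n}.
        (\<Oplus>\<^bsub>A\<^esub>i\<in>{1..n}. x i k \<otimes>\<^bsub>A\<^esub> x i l) = delta A k l) \<and>
     eps_relations n \<epsilon> A x"

text \<open>The universal property cannot quantify over all types. In a C*-algebra of any type, the
  C*-subalgebra generated by finitely many elements is separable, so it has at most the
  cardinality of the continuum and is isomorphic to one with carrier in \<^typ>\<open>nat \<Rightarrow> nat\<close>.
  Hence testing against C*-algebras on this type is no restriction.\<close>

definition universal_O ::
  "nat \<Rightarrow> (nat \<Rightarrow> nat \<Rightarrow> nat) \<Rightarrow> 'a cstar \<Rightarrow> (nat \<Rightarrow> nat \<Rightarrow> 'a) \<Rightarrow> bool" where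
  "universal_O n \<epsilon> A u \<longleftrightarrow>
     unital_cstar_algebra A \<and> O_relations n \<epsilon> A u \<and> cstar_generates A (entries n u) \<and>
     (\<forall>(B :: (nat \<Rightarrow> nat) cstar) v. unital_cstar_algebra B \<and> O_relations n \<epsilon> B v \<longrightarrow>
        (\<exists>\<phi> \<in> unital_star_hom A B. \<forall>i\<in>{1..n}. \<forall>j\<in>{1..n}. \<phi> (u i j) = v i j))"

definition universal_X ::
  "nat \<Rightarrow> (nat \<Rightarrow> nat \<Rightarrow> nat) \<Rightarrow> 'a cstar \<Rightarrow> (nat \<Rightarrow> nat \<Rightarrow> 'a) \<Rightarrow> bool" where
  "universal_X n \<epsilon> A x \<longleftrightarrow>
     unital_cstar_algebra A \<and> X_relations n \<epsilon> A x \<and> cstar_generates A (entries n x) \<and>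
     (\<forall>(B :: (nat \<Rightarrow> nat) cstar) y. unital_cstar_algebra B \<and> X_relations n \<epsilon> B y \<longrightarrow>
        (\<exists>\<phi> \<in> unital_star_hom A B. \<forall>i\<in>{1..n}. \<forall>j\<in>{1..n}. \<phi> (x i j) = y i j))"

text \<open>\<open>T\<close> and \<open>tens\<close> supply the minimal tensor product of \<open>A\<close> and \<open>B\<close>.\<close>

definition acts_by ::
  "nat \<Rightarrow> 'a cstar \<Rightarrow> (nat \<Rightarrow> nat \<Rightarrow> 'a) \<Rightarrow> 'x cstar \<Rightarrow> (nat \<Rightarrow> nat \<Rightarrow> 'x) \<Rightarrow>
   't cstar \<Rightarrow> ('a \<Rightarrow> 'x \<Rightarrow> 't) \<Rightarrow> bool" where
  "acts_by n A u B x T tens \<longleftrightarrow>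
     (\<exists>\<alpha> \<in> unital_star_hom B T. \<forall>i\<in>{1..n}. \<forall>k\<in>{1..n}.
        \<alpha> (x i k) = (\<Oplus>\<^bsub>T\<^esub>j\<in>{1..n}. tens (u i j) (x j k))) \<and>
     (\<exists>\<beta> \<in> unital_star_hom B T. \<forall>i\<in>{1..n}. \<forall>k\<in>{1..n}.
        \<beta> (x i k) = (\<Oplus>\<^bsub>T\<^esub>j\<in>{1..n}. tens (u j i) (x j k)))"

end

theory Submission
  imports Defs
begin

text \<open>Slicing the second leg of \<open>C(G) \<otimes> C(X)\<close> by the character that sends \<open>x\<close> to the identity
  matrix turns \<open>\<alpha> (x i k)\<close> into \<open>v i k\<close>, so each relation of \<open>x\<close> passes to \<open>v\<close>, and through \<open>\<beta>\<close> to
  its transpose; together these are the relations of the orthogonal quantum group. Conversely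
  \<open>\<Sum>\<^sub>j u i j \<otimes> x j k\<close> satisfies the relations because the mixed terms vanish in one of the two legs.
  The remaining analytic point is that the induced map onto \<open>C(G)\<close> is surjective, that is, that
  the range of a *-homomorphism is closed. This is shown without functional calculus, by lifting
  elements of the range through \<open>(1 + i h/m)\<^sup>m\<close>.\<close>

section \<open>Norm limits in a C*-algebra\<close>

text \<open>The obstacle is that only the axioms of \<open>unital_cstar_algebra\<close> are
  available: no spectrum and not even continuity of a *-homomorphism. Each analytic fact is
  therefore reached through an element whose norm the C*-identity controls. An isometry has norm at
  most 1 and is mapped to an isometry; writing a small self-adjoint element as the real part of one
  gives continuity. The powers of 1 + i h/m stand in for the unitary exp(i h), which has norm 1
  however large h is, while its image depends only on the possibly small \<open>\<phi> h\<close>;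
  this turns a preimage of unknown size into one of bounded size.

  The slice is a relation on finite sums of elementary tensors. All elements it is applied to are of
  this kind, so only its single-valuedness has to be established, not its boundedness on the
  completion; matrix coefficients in the two faithful representations give it.

  The universal properties are tested only on algebras over \<open>nat \<Rightarrow> nat\<close>,
  whereas the tensor products, C(G) and the complex numbers live in other types. Copying a countably
  generated subalgebra to that type bridges the gap.\<close>

lemma ring_of_type_algebra_sel:
  "carrier ring_of_type_algebra = UNIV"
  "x \<otimes>\<^bsub>ring_of_type_algebra\<^esub> y = x * y"
  "x \<oplus>\<^bsub>ring_of_type_algebra\<^esub> y = x + y"
  "\<one>\<^bsub>ring_of_type_algebra\<^esub> = 1"
  "\<zero>\<^bsub>ring_of_type_algebra\<^esub> = 0"
  by (simp_all add: ring_of_type_algebra_def)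

context unital_cstar_algebra
begin

lemma scale_closed [simp, intro]: "x \<in> carrier A \<Longrightarrow> c \<odot> x \<in> carrier A"
  by (simp add: smult_closed ring_of_type_algebra_sel)

lemma scale_add_left: "x \<in> carrier A \<Longrightarrow> (a + b) \<odot> x = a \<odot> x \<oplus> b \<odot> x"
  using smult_l_distr[of a b x] by (simp add: ring_of_type_algebra_sel)

lemma scale_add_right:
  "x \<in> carrier A \<Longrightarrow> y \<in> carrier A \<Longrightarrow> c \<odot> (x \<oplus> y) = c \<odot> x \<oplus> c \<odot> y"
  by (simp add: smult_r_distr ring_of_type_algebra_sel)

lemma scale_scale: "x \<in> carrier A \<Longrightarrow> a \<odot> (b \<odot> x) = (a * b) \<odot> x"
  using smult_assoc1[of a b x] by (simp add: ring_of_type_algebra_sel)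

lemma scale_one [simp]: "x \<in> carrier A \<Longrightarrow> 1 \<odot> x = x"
  using smult_one[of x] by (simp add: ring_of_type_algebra_sel)

lemma scale_zero_left [simp]: "x \<in> carrier A \<Longrightarrow> 0 \<odot> x = \<zero>"
  using smult_l_null[of x] by (simp add: ring_of_type_algebra_sel)

lemma scale_zero_right [simp]: "c \<odot> \<zero> = \<zero>"
  using smult_r_null[of c] by (simp add: ring_of_type_algebra_sel)

lemma minus_eq_scale: "x \<in> carrier A \<Longrightarrow> \<ominus> x = (-1) \<odot> x"
  using scale_add_left[of x "-1" 1] by (intro minus_equality) auto

lemma diff_eq_scale: "x \<in> carrier A \<Longrightarrow> y \<in> carrier A \<Longrightarrow> x \<ominus> y = x \<oplus> (-1) \<odot> y"
  by (simp add: minus_eq minus_eq_scale)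

lemma scale_diff_right:
  "x \<in> carrier A \<Longrightarrow> y \<in> carrier A \<Longrightarrow> c \<odot> (x \<ominus> y) = c \<odot> x \<ominus> c \<odot> y"
  by (simp add: diff_eq_scale scale_add_right scale_scale)

lemmas [simp, intro] = star_closed
lemmas [simp] = star_star

lemma star_zero [simp]: "star A \<zero> = \<zero>"
  using star_smult[of \<zero> 0] by simp

lemma star_one [simp]: "star A \<one> = \<one>"
proof -
  have "star A \<one> = star A \<one> \<otimes> star A (star A \<one>)"
    by simp
  also have "\<dots> = star A (star A \<one> \<otimes> \<one>)"
    using star_mult[of "star A \<one>" \<one>] by simp
  finally show ?thesis by simp
qed

lemma star_diff: "x \<in> carrier A \<Longrightarrow> y \<in> carrier A \<Longrightarrow> star A (x \<ominus> y) = star A x \<ominus> star A y"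
  by (simp add: diff_eq_scale star_add star_smult)

lemma star_finsum:
  assumes "finite I" "\<And>i. i \<in> I \<Longrightarrow> f i \<in> carrier A"
  shows "star A (finsum A f I) = (\<Oplus>i\<in>I. star A (f i))"
  using assms
proof (induction I rule: finite_induct)
  case (insert j J)
  then have "f \<in> J \<rightarrow> carrier A" by auto
  with insert show ?case by (auto simp: finsum_insert star_add Pi_def)
qed simp

lemma finsum_commute:
  assumes "finite I" "finite J" "\<And>i j. i \<in> I \<Longrightarrow> j \<in> J \<Longrightarrow> f i j \<in> carrier A"
  shows "(\<Oplus>i\<in>I. \<Oplus>j\<in>J. f i j) = (\<Oplus>j\<in>J. \<Oplus>i\<in>I. f i j)"
  using assms(1,3)
proof (induction I rule: finite_induct)
  case empty
  then show ?case by (simp add: finsum_zero)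
next
  case (insert k K)
  have "(\<Oplus>j\<in>J. \<Oplus>i\<in>insert k K. f i j) = (\<Oplus>j\<in>J. f k j \<oplus> (\<Oplus>i\<in>K. f i j))"
    using insert by (intro finsum_cong') (auto simp: Pi_def)
  also have "\<dots> = (\<Oplus>j\<in>J. f k j) \<oplus> (\<Oplus>j\<in>J. \<Oplus>i\<in>K. f i j)"
    using insert by (intro finsum_addf) (auto simp: Pi_def)
  also have "\<dots> = (\<Oplus>i\<in>insert k K. \<Oplus>j\<in>J. f i j)"
    using insert by (subst finsum_insert) (auto simp: Pi_def)
  finally show ?case ..
qed

section \<open>Norm estimates from the C*-identity and the triangle inequality\<close>

lemma norm_zero [simp]: "cnorm A \<zero> = 0"
  by (simp add: cnorm_eq_0_iff)

text \<open>The C*-identity makes this norm a root of t^2 = t. Equality with 1 fails in the zero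
  algebra, which the axioms admit.\<close>

lemma norm_one_le: "cnorm A \<one> \<le> 1"
proof -
  have "(cnorm A \<one>)\<^sup>2 = cnorm A \<one>"
    using cstar_identity[of \<one>] by simp
  then show ?thesis
    by (metis cnorm_nonneg mult_cancel_right2 one_closed order_refl power2_eq_square zero_le_one)
qed

text \<open>The C*-identity and submultiplicativity bound the square of the norm of \<open>x\<close>
  by the product of the norms of \<open>star A x\<close> and \<open>x\<close>. Cancelling a factor
  gives one inequality; exchanging \<open>x\<close> and \<open>star A x\<close> gives the
  other.\<close>

lemma norm_star [simp]:
  assumes "x \<in> carrier A" shows "cnorm A (star A x) = cnorm A x"
proof -
  have le: "cnorm A y \<le> cnorm A (star A y)" if "y \<in> carrier A" for y
  proof -
    have "cnorm A y * cnorm A y \<le> cnorm A (star A y) * cnorm A y"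
      using cnorm_mult[of "star A y" y] cstar_identity[of y] that by (simp add: power2_eq_square)
    then show ?thesis
      using that cnorm_nonneg[of y] cnorm_nonneg[of "star A y"]
      by (metis mult_right_le_imp_le order_le_less star_closed)
  qed
  show ?thesis
    using le[OF assms] le[of "star A x"] assms by simp
qed

lemma norm_diff_commute:
  assumes "x \<in> carrier A" "y \<in> carrier A"
  shows "cnorm A (x \<ominus> y) = cnorm A (y \<ominus> x)"
proof -
  have "x \<ominus> y = (-1) \<odot> (y \<ominus> x)"
    using assms by (simp add: diff_eq_scale scale_add_right scale_scale a_comm)
  then show ?thesis
    using assms by (simp add: cnorm_smult)
qed

lemma diff_split:
  assumes "x \<in> carrier A" "y \<in> carrier A" "z \<in> carrier A"
  shows "x \<ominus> z = (x \<ominus> y) \<oplus> (y \<ominus> z)"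
proof -
  have "y \<oplus> (\<ominus> y \<oplus> (x \<ominus> z)) = x \<ominus> z"
    using assms by (simp add: r_neg1 r_neg2)
  then show ?thesis
    using assms by (simp add: minus_eq a_ac r_neg1)
qed

lemma norm_minus [simp]: "x \<in> carrier A \<Longrightarrow> cnorm A (\<ominus> x) = cnorm A x"
  by (simp add: minus_eq_scale cnorm_smult)

lemma add_diff_cancel:
  "x \<in> carrier A \<Longrightarrow> y \<in> carrier A \<Longrightarrow> (x \<oplus> y) \<ominus> x = y"
  by (simp add: minus_eq a_comm[of x y] a_assoc r_neg)

lemma diff_self: "x \<in> carrier A \<Longrightarrow> x \<ominus> x = \<zero>"
  by (simp add: minus_eq r_neg)

lemma diff_eq_zeroD:
  assumes "x \<in> carrier A" "y \<in> carrier A" "x \<ominus> y = \<zero>"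
  shows "x = y"
  using assms by (metis add.inv_closed minus_equality minus_eq minus_minus)

lemma norm_diff_triangle:
  assumes "x \<in> carrier A" "y \<in> carrier A" "z \<in> carrier A"
  shows "cnorm A (x \<ominus> z) \<le> cnorm A (x \<ominus> y) + cnorm A (y \<ominus> z)"
  using cnorm_triangle[of "x \<ominus> y" "y \<ominus> z"] diff_split[OF assms] assms by simp

lemma norm_le_add_diff:
  assumes "x \<in> carrier A" "y \<in> carrier A"
  shows "cnorm A x \<le> cnorm A (x \<ominus> y) + cnorm A y"
  using norm_diff_triangle[of x y \<zero>] assms by (simp add: minus_eq)

lemma diff_add_add:
  assumes "x \<in> carrier A" "y \<in> carrier A" "x' \<in> carrier A" "y' \<in> carrier A"
  shows "(x \<oplus> y) \<ominus> (x' \<oplus> y') = (x \<ominus> x') \<oplus> (y \<ominus> y')"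
  using assms by (simp add: minus_eq minus_add a_ac)

lemma norm_diff_add_add:
  assumes "x \<in> carrier A" "y \<in> carrier A" "x' \<in> carrier A" "y' \<in> carrier A"
  shows "cnorm A ((x \<oplus> y) \<ominus> (x' \<oplus> y')) \<le> cnorm A (x \<ominus> x') + cnorm A (y \<ominus> y')"
  using cnorm_triangle[of "x \<ominus> x'" "y \<ominus> y'"] assms by (simp add: diff_add_add)

lemma diff_mult_left:
  assumes "x \<in> carrier A" "y \<in> carrier A" "z \<in> carrier A"
  shows "(x \<otimes> z) \<ominus> (y \<otimes> z) = (x \<ominus> y) \<otimes> z"
  using assms by (simp add: diff_eq_scale l_distr smult_mult_left)

lemma diff_mult_right:
  assumes "x \<in> carrier A" "y \<in> carrier A" "z \<in> carrier A"
  shows "(z \<otimes> x) \<ominus> (z \<otimes> y) = z \<otimes> (x \<ominus> y)"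
  using assms by (simp add: diff_eq_scale r_distr smult_mult_right)

lemma norm_diff_mult_mult:
  assumes "x \<in> carrier A" "y \<in> carrier A" "x' \<in> carrier A" "y' \<in> carrier A"
  shows "cnorm A ((x \<otimes> y) \<ominus> (x' \<otimes> y'))
    \<le> cnorm A (x \<ominus> x') * cnorm A y + cnorm A x' * cnorm A (y \<ominus> y')"
proof -
  have "cnorm A ((x \<otimes> y) \<ominus> (x' \<otimes> y'))
      \<le> cnorm A ((x \<ominus> x') \<otimes> y) + cnorm A (x' \<otimes> (y \<ominus> y'))"
    using norm_diff_triangle[of "x \<otimes> y" "x' \<otimes> y" "x' \<otimes> y'"] assms
    by (simp add: diff_mult_left diff_mult_right)
  then show ?thesis
    using cnorm_mult[of "x \<ominus> x'" y] cnorm_mult[of x' "y \<ominus> y'"] assms by simp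
qed

lemma norm_diff_scale:
  assumes "x \<in> carrier A" "y \<in> carrier A"
  shows "cnorm A (c \<odot> x \<ominus> c \<odot> y) = cmod c * cnorm A (x \<ominus> y)"
  using assms by (simp add: cnorm_smult flip: scale_diff_right)

lemma norm_diff_star:
  assumes "x \<in> carrier A" "y \<in> carrier A"
  shows "cnorm A (star A x \<ominus> star A y) = cnorm A (x \<ominus> y)"
  using assms by (simp flip: star_diff)

text \<open>Membership in the carrier is bundled in, because the norm laws hold only there and every
  limit rule would otherwise carry these side conditions.\<close>

definition clim :: "(nat \<Rightarrow> 'a) \<Rightarrow> 'a \<Rightarrow> bool" where
  "clim s x \<longleftrightarrow> range s \<subseteq> carrier A \<and> x \<in> carrier A \<and> (\<lambda>k. cnorm A (s k \<ominus> x)) \<longlonglongrightarrow> 0"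

lemma climD:
  assumes "clim s x"
  shows "s k \<in> carrier A" "x \<in> carrier A" "(\<lambda>k. cnorm A (s k \<ominus> x)) \<longlonglongrightarrow> 0"
  using assms by (auto simp: clim_def)

lemma climI:
  assumes "\<And>k. s k \<in> carrier A" "x \<in> carrier A" "\<And>k. cnorm A (s k \<ominus> x) \<le> b k" "b \<longlonglongrightarrow> 0"
  shows "clim s x"
  unfolding clim_def
proof (intro conjI)
  show "(\<lambda>k. cnorm A (s k \<ominus> x)) \<longlonglongrightarrow> 0"
    by (rule tendsto_sandwich[OF _ _ tendsto_const assms(4)]) (use assms cnorm_nonneg in auto)
qed (use assms in auto)

lemma clim_const [intro]: "x \<in> carrier A \<Longrightarrow> clim (\<lambda>_. x) x"
  by (simp add: clim_def diff_self)

lemma clim_unique: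
  assumes "clim s x" "clim s y" shows "x = y"
proof -
  note c = climD[OF assms(1)] climD[OF assms(2)]
  have "(\<lambda>k. cnorm A (s k \<ominus> x) + cnorm A (s k \<ominus> y)) \<longlonglongrightarrow> 0"
    using tendsto_add[OF c(3,6)] by simp
  then have "cnorm A (x \<ominus> y) \<le> 0"
  proof (rule LIMSEQ_le_const, intro exI allI impI)
    fix k
    show "cnorm A (x \<ominus> y) \<le> cnorm A (s k \<ominus> x) + cnorm A (s k \<ominus> y)"
      using norm_diff_triangle[of x "s k" y] norm_diff_commute[of x "s k"] c by simp
  qed
  then have "x \<ominus> y = \<zero>"
    using cnorm_eq_0_iff[of "x \<ominus> y"] cnorm_nonneg[of "x \<ominus> y"] c by simp
  then show ?thesis
    using c by (blast intro: diff_eq_zeroD)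
qed

lemma clim_add:
  assumes "clim s x" "clim t y" shows "clim (\<lambda>k. s k \<oplus> t k) (x \<oplus> y)"
proof -
  note c = climD[OF assms(1)] climD[OF assms(2)]
  show ?thesis
    using tendsto_add[OF c(3,6)] c norm_diff_add_add
    by (intro climI[where b = "\<lambda>k. cnorm A (s k \<ominus> x) + cnorm A (t k \<ominus> y)"]) auto
qed

lemma clim_norm_bounded:
  assumes "clim s x" shows "\<exists>B. \<forall>k. cnorm A (s k) \<le> B"
proof -
  note c = climD[OF assms]
  obtain B where "\<And>k. norm (cnorm A (s k \<ominus> x)) \<le> B"
    using c(3) by (metis Bseq_def convergentI convergent_imp_Bseq)
  then have "cnorm A (s k) \<le> B + cnorm A x" for k
    using norm_le_add_diff[of "s k" x] c by (smt (verit) real_norm_def)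
  then show ?thesis by blast
qed

lemma clim_mult:
  assumes "clim s x" "clim t y" shows "clim (\<lambda>k. s k \<otimes> t k) (x \<otimes> y)"
proof -
  note c = climD[OF assms(1)] climD[OF assms(2)]
  obtain B where B: "\<And>k. cnorm A (t k) \<le> B"
    using clim_norm_bounded[OF assms(2)] by blast
  have "(\<lambda>k. cnorm A (s k \<ominus> x) * B + cnorm A x * cnorm A (t k \<ominus> y)) \<longlonglongrightarrow> 0 * B + cnorm A x * 0"
    by (intro tendsto_intros c)
  moreover have "cnorm A ((s k \<otimes> t k) \<ominus> (x \<otimes> y))
      \<le> cnorm A (s k \<ominus> x) * B + cnorm A x * cnorm A (t k \<ominus> y)" for k
    using norm_diff_mult_mult[of "s k" "t k" x y] mult_left_mono[OF B[of k], of "cnorm A (s k \<ominus> x)"] c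
    by (smt (verit) cnorm_nonneg minus_closed)
  ultimately show ?thesis
    using c by (intro climI[where b = "\<lambda>k. cnorm A (s k \<ominus> x) * B + cnorm A x * cnorm A (t k \<ominus> y)"]) auto
qed

lemma clim_star:
  assumes "clim s x" shows "clim (\<lambda>k. star A (s k)) (star A x)"
  using climD[OF assms] by (intro climI[OF _ _ _ climD(3)[OF assms]]) (auto simp: norm_diff_star)

text \<open>A scalar acts as the corresponding multiple of \<open>\<one>\<close>, so this is an
  instance of the product rule. The scalars may vary with k, so that rational coefficients can
  approach a complex one.\<close>

lemma clim_scale:
  assumes "a \<longlonglongrightarrow> c" "clim s x" shows "clim (\<lambda>k. a k \<odot> s k) (c \<odot> x)"
proof -
  note c = climD[OF assms(2)]
  have "clim (\<lambda>k. a k \<odot> \<one>) (c \<odot> \<one>)"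
  proof (rule climI[where b = "\<lambda>k. cmod (a k - c)"])
    show "(\<lambda>k. cmod (a k - c)) \<longlonglongrightarrow> 0"
      using assms(1) LIM_zero tendsto_norm_zero by blast
    fix k
    have "a k \<odot> \<one> \<ominus> c \<odot> \<one> = (a k - c) \<odot> \<one>"
      using scale_add_left[of \<one> "a k" "- c"] by (simp add: diff_eq_scale scale_scale)
    then show "cnorm A (a k \<odot> \<one> \<ominus> c \<odot> \<one>) \<le> cmod (a k - c)"
      by (simp add: cnorm_smult mult_left_le norm_one_le)
  qed auto
  from clim_mult[OF this assms(2)] show ?thesis
    using c by (simp add: smult_mult_left)
qed

lemma clim_Suc: "clim s x \<Longrightarrow> clim (\<lambda>k. s (Suc k)) x"
  unfolding clim_def by (auto dest: LIMSEQ_Suc)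

lemma norm_closedD: "norm_closed A S \<Longrightarrow> clim s x \<Longrightarrow> range s \<subseteq> S \<Longrightarrow> x \<in> S"
  unfolding norm_closed_def clim_def by blast

lemma norm_closedI:
  assumes "S \<subseteq> carrier A" "\<And>s x. clim s x \<Longrightarrow> range s \<subseteq> S \<Longrightarrow> x \<in> S"
  shows "norm_closed A S"
  unfolding norm_closed_def clim_def using assms(1) assms(2)[unfolded clim_def] by blast

text \<open>Telescoping and the geometric series give the Cauchy property. It serves both limit
  constructions: the square root by a fixed-point iteration and the exact preimage by successive
  corrections.\<close>

lemma geometric_clim:
  assumes "\<And>k. s k \<in> carrier A" "0 \<le> q" "q < 1" "\<And>k. cnorm A (s (Suc k) \<ominus> s k) \<le> M * q ^ k"
  shows "\<exists>x. clim s x"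
proof -
  have M: "0 \<le> M"
    using assms(4)[of 0] cnorm_nonneg[of "s (Suc 0) \<ominus> s 0"] assms(1) by (smt (verit) minus_closed mult_cancel_left1 power_0)
  \<comment> \<open>The exact partial geometric sum is kept, since the coarser bound of
    \<open>tail'\<close> does not survive an induction that adds the last step.\<close>
  have tail: "cnorm A (s (k + m) \<ominus> s k) \<le> M * q ^ k * (1 - q ^ m) / (1 - q)" for k m
  proof (induction m)
    case 0
    then show ?case using assms by (simp add: diff_self)
  next
    case (Suc m)
    have "cnorm A (s (k + Suc m) \<ominus> s k) \<le> M * q ^ (k + m) + M * q ^ k * (1 - q ^ m) / (1 - q)"
      using norm_diff_triangle[of "s (k + Suc m)" "s (k + m)" "s k"] assms(1) assms(4)[of "k + m"] Suc
      by fastforce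
    also have "\<dots> = M * q ^ k * (1 - q ^ Suc m) / (1 - q)"
      using assms(3) by (simp add: field_simps power_add)
    finally show ?case .
  qed
  have tail': "cnorm A (s (k + m) \<ominus> s k) \<le> M / (1 - q) * q ^ k" for k m
  proof -
    have "M * q ^ k * (1 - q ^ m) \<le> M * q ^ k * 1"
      using M assms by (intro mult_left_mono) auto
    then have "M * q ^ k * (1 - q ^ m) / (1 - q) \<le> M * q ^ k / (1 - q)"
      using assms(3) by (intro divide_right_mono) auto
    then show ?thesis using tail[of k m] by simp
  qed
  have "\<exists>x\<in>carrier A. (\<lambda>k. cnorm A (s k \<ominus> x)) \<longlonglongrightarrow> 0"
  proof (rule complete)
    fix e :: real assume "e > 0"
    have "(\<lambda>k. M / (1 - q) * q ^ k) \<longlonglongrightarrow> M / (1 - q) * 0"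
      using assms by (intro tendsto_intros LIMSEQ_realpow_zero) auto
    then have "\<forall>\<^sub>F k in sequentially. M / (1 - q) * q ^ k < e / 2"
      using \<open>e > 0\<close> by (intro order_tendstoD(2)[of _ 0]) auto
    then obtain N where N: "M / (1 - q) * q ^ N < e / 2"
      by (auto simp: eventually_sequentially)
    have "cnorm A (s k \<ominus> s l) < e" if "k \<ge> N" "l \<ge> N" for k l
    proof -
      have "cnorm A (s k \<ominus> s N) < e / 2" "cnorm A (s l \<ominus> s N) < e / 2"
        using tail'[of N "k - N"] tail'[of N "l - N"] that le_less_trans[OF _ N]
        by (metis le_add_diff_inverse)+
      then show ?thesis
        using norm_diff_triangle[of "s k" "s N" "s l"] norm_diff_commute[of "s l" "s N"] assms(1)
        by simp
    qed
    then show "\<exists>N. \<forall>k\<ge>N. \<forall>l\<ge>N. cnorm A (s k \<ominus> s l) < e" by blast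
  qed (use assms(1) in auto)
  then show ?thesis
    using assms(1) by (auto simp: clim_def)
qed

end

section \<open>The range of a *-homomorphism is closed\<close>

context unital_cstar_algebra
begin

lemma scale_cancel: "x \<in> carrier A \<Longrightarrow> c \<odot> x \<oplus> (- c) \<odot> x = \<zero>"
  using scale_add_left[of x c "- c"] by simp

section \<open>Self-adjoint parts and isometries\<close>

definition re_part :: "'a \<Rightarrow> 'a" where
  "re_part x = (1/2) \<odot> (x \<oplus> star A x)"

lemma re_part_closed [simp, intro]: "x \<in> carrier A \<Longrightarrow> re_part x \<in> carrier A"
  by (simp add: re_part_def)

lemma star_re_part [simp]: "x \<in> carrier A \<Longrightarrow> star A (re_part x) = re_part x"
  by (simp add: re_part_def star_smult star_add a_comm)

lemma norm_re_part_le: "x \<in> carrier A \<Longrightarrow> cnorm A (re_part x) \<le> cnorm A x"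
  using cnorm_triangle[of x "star A x"] by (simp add: re_part_def cnorm_smult)

lemma scale_half_double: "y \<in> carrier A \<Longrightarrow> (1/2) \<odot> (y \<oplus> y) = y"
  using scale_add_left[of y "1/2" "1/2"] by (simp add: scale_add_right)

lemma re_part_self_adjoint: "y \<in> carrier A \<Longrightarrow> star A y = y \<Longrightarrow> re_part y = y"
  by (simp add: re_part_def scale_half_double)

lemma re_part_diff:
  assumes "x \<in> carrier A" "y \<in> carrier A"
  shows "re_part (x \<ominus> y) = re_part x \<ominus> re_part y"
  using assms by (simp add: re_part_def star_diff diff_add_add flip: scale_diff_right)

text \<open>Taking the self-adjoint part is contractive and fixes \<open>y\<close>, so an
  approximant of a self-adjoint element can be made self-adjoint at no cost.\<close>

lemma norm_re_part_diff_le: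
  assumes "x \<in> carrier A" "y \<in> carrier A" "star A y = y"
  shows "cnorm A (re_part x \<ominus> y) \<le> cnorm A (x \<ominus> y)"
  using norm_re_part_le[of "x \<ominus> y"] assms by (simp add: re_part_diff re_part_self_adjoint)

lemma norm_le_one_of_isometry:
  assumes "x \<in> carrier A" "star A x \<otimes> x = \<one>" shows "cnorm A x \<le> 1"
proof -
  have "(cnorm A x)\<^sup>2 \<le> 1"
    using cstar_identity[of x] assms norm_one_le by simp
  then show ?thesis
    using abs_le_square_iff[of "cnorm A x" 1] by simp
qed

text \<open>The isometry is \<open>h + i \<surd>(1 - h\<^sup>2)\<close>; the square root is \<open>1 - w\<close> for the fixed point
  \<open>w = (h\<^sup>2 + w\<^sup>2) / 2\<close>.\<close>

lemma re_part_of_isometry: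
  assumes h: "h \<in> carrier A" "star A h = h" and small: "cnorm A h \<le> 1/2"
  shows "\<exists>v\<in>carrier A. star A v \<otimes> v = \<one> \<and> re_part v = h"
proof -
  define y where "y = h \<otimes> h"
  have y: "y \<in> carrier A" "star A y = y" "h \<otimes> y = y \<otimes> h"
    using h by (simp_all add: y_def star_mult m_assoc)
  have normy: "cnorm A y \<le> 1/4"
    using cnorm_mult[of h h] h mult_mono[OF small small] cnorm_nonneg[of h] by (simp add: y_def)
  \<comment> \<open>Expanding (1 - w)^2 = 1 - y and solving for the linear term gives this
    iteration; it starts at zero, so every iterate is a polynomial in \<open>y\<close>.\<close>
  define s where "s = rec_nat \<zero> (\<lambda>_ w. (1/2) \<odot> (y \<oplus> w \<otimes> w))"
  have s0: "s 0 = \<zero>" and sSuc: "s (Suc k) = (1/2) \<odot> (y \<oplus> s k \<otimes> s k)" for k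
    by (simp_all add: s_def)
  have sc: "s k \<in> carrier A" for k
    by (induction k) (use y in \<open>simp_all add: s0 sSuc\<close>)
  have ss: "star A (s k) = s k" for k
    by (induction k) (use y sc in \<open>simp_all add: s0 sSuc star_smult star_add star_mult\<close>)
  \<comment> \<open>Commutation with \<open>h\<close> has to reach the limit, since it is what
    cancels the mixed terms of the isometry.\<close>
  have sh: "h \<otimes> s k = s k \<otimes> h" for k
  proof (induction k)
    case (Suc k)
    have "h \<otimes> (s k \<otimes> s k) = s k \<otimes> s k \<otimes> h"
      using Suc sc h by (metis m_assoc)
    then show ?case
      using y sc h by (simp add: sSuc smult_mult_left smult_mult_right l_distr r_distr)
  qed (use h in \<open>simp add: s0\<close>)
  \<comment> \<open>The ball of radius 1/4 is invariant because (1/4 + 1/16)/2 is below 1/4; the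
    first 1/4 is the bound on the square of \<open>h\<close>.\<close>
  have sn: "cnorm A (s k) \<le> 1/4" for k
  proof (induction k)
    case (Suc k)
    have "cnorm A (s k \<otimes> s k) \<le> 1/4 * (1/4)"
      using cnorm_mult[OF sc sc, of k k] mult_mono[OF Suc Suc] cnorm_nonneg[OF sc] by fastforce
    then show ?case
      using cnorm_triangle[of y "s k \<otimes> s k"] normy y sc by (simp add: sSuc cnorm_smult)
  qed (simp add: s0)
  \<comment> \<open>On that ball the iteration has Lipschitz constant 1/4: the difference of two
    squares contributes 1/4 twice, and the sum is halved.\<close>
  have step: "cnorm A (s (Suc k) \<ominus> s k) \<le> 1 * (1/4) ^ k" for k
  proof (induction k)
    case 0
    show ?case using sn[of 1] y sc[of 1] by (simp add: s0 minus_eq)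
  next
    case (Suc k)
    have "cnorm A (s (Suc (Suc k)) \<ominus> s (Suc k))
        = (1/2) * cnorm A ((y \<oplus> s (Suc k) \<otimes> s (Suc k)) \<ominus> (y \<oplus> s k \<otimes> s k))"
      using norm_diff_scale[of "y \<oplus> s (Suc k) \<otimes> s (Suc k)" "y \<oplus> s k \<otimes> s k" "1/2"] y sc
      by (simp flip: sSuc)
    also have "\<dots> \<le> (1/2) * cnorm A ((s (Suc k) \<otimes> s (Suc k)) \<ominus> (s k \<otimes> s k))"
      using norm_diff_add_add[of y "s (Suc k) \<otimes> s (Suc k)" y "s k \<otimes> s k"] y sc
      by (simp add: diff_self)
    also have "\<dots> \<le> (1/2) * (cnorm A (s (Suc k) \<ominus> s k) * (1/4) + 1/4 * cnorm A (s (Suc k) \<ominus> s k))"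
    proof -
      have "cnorm A (s (Suc k) \<ominus> s k) * cnorm A (s (Suc k)) \<le> cnorm A (s (Suc k) \<ominus> s k) * (1/4)"
        "cnorm A (s k) * cnorm A (s (Suc k) \<ominus> s k) \<le> 1/4 * cnorm A (s (Suc k) \<ominus> s k)"
        by (intro mult_left_mono mult_right_mono sn cnorm_nonneg minus_closed sc)+
      then show ?thesis
        using norm_diff_mult_mult[OF sc sc sc sc, of "Suc k" "Suc k" k k] by simp
    qed
    also have "\<dots> \<le> 1 * (1/4) ^ Suc k"
      using Suc by simp
    finally show ?case .
  qed
  obtain w where w: "clim s w"
    using geometric_clim[OF sc _ _ step] by auto
  have wc: "w \<in> carrier A" using climD(2)[OF w] .
  have "clim (\<lambda>k. s (Suc k)) ((1/2) \<odot> (y \<oplus> w \<otimes> w))"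
    unfolding sSuc using y by (intro clim_scale clim_add clim_mult w clim_const tendsto_const)
  with clim_Suc[OF w] have w_eq: "w = (1/2) \<odot> (y \<oplus> w \<otimes> w)"
    by (rule clim_unique)
  have "clim s (star A w)"
    using clim_star[OF w] by (simp only: ss)
  then have ws: "star A w = w"
    using w by (rule clim_unique)
  have "clim (\<lambda>k. s k \<otimes> h) (h \<otimes> w)"
    using clim_mult[OF clim_const[OF h(1)] w] by (simp only: sh)
  then have wh: "h \<otimes> w = w \<otimes> h"
    using clim_mult[OF w clim_const[OF h(1)]] by (rule clim_unique)
  have ww: "w \<oplus> w = y \<oplus> w \<otimes> w"
    using scale_add_left[of "y \<oplus> w \<otimes> w" "1/2" "1/2"] y wc unfolding w_eq[symmetric] by simp
  define c where "c = \<one> \<ominus> w"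
  have cc: "c \<in> carrier A" "star A c = c" "h \<otimes> c = c \<otimes> h"
    using wc ws wh h diff_mult_left[of \<one> w h] diff_mult_right[of \<one> w h]
    by (simp_all add: c_def star_diff)
  have "c \<otimes> c = (\<one> \<oplus> w \<otimes> w) \<ominus> (w \<oplus> w)"
    using wc by (simp add: c_def minus_eq l_distr r_distr l_minus r_minus minus_add a_ac)
  then have yc: "y \<oplus> c \<otimes> c = \<one>"
    using wc y by (simp add: ww minus_eq minus_add a_ac r_neg r_neg1 r_neg2 a_lcomm[of y \<one>])
  define v where "v = h \<oplus> \<i> \<odot> c"
  have v: "v \<in> carrier A" "star A v = h \<oplus> (- \<i>) \<odot> c"
    using h cc by (simp_all add: v_def star_add star_smult)
  \<comment> \<open>As \<open>h\<close> and \<open>c\<close> commute, the mixed terms are opposite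
    multiples of one product.\<close>
  have "star A v \<otimes> v = y \<oplus> c \<otimes> c \<oplus> (\<i> \<odot> (h \<otimes> c) \<oplus> (- \<i>) \<odot> (h \<otimes> c))"
    using h cc y unfolding v(2) unfolding v_def
    by (simp add: l_distr r_distr smult_mult_left smult_mult_right scale_scale scale_add_right
        y_def a_ac)
  also have "\<dots> = \<one>"
    using yc h cc by (simp add: scale_cancel)
  finally have "star A v \<otimes> v = \<one>" .
  moreover have "re_part v = h"
  proof -
    have "v \<oplus> star A v = (h \<oplus> h) \<oplus> (\<i> \<odot> c \<oplus> (- \<i>) \<odot> c)"
      using h cc unfolding v(2) unfolding v_def by (simp add: a_ac)
    also have "\<dots> = h \<oplus> h"
      using h cc by (simp add: scale_cancel)
    finally show ?thesis
      using h by (simp add: re_part_def scale_half_double)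
  qed
  ultimately show ?thesis using v by blast
qed

section \<open>Norms of powers of 1 + x\<close>

lemma norm_pow_le: "x \<in> carrier A \<Longrightarrow> cnorm A (x [^] (m::nat)) \<le> cnorm A x ^ m"
proof (induction m)
  case (Suc m)
  have "cnorm A (x [^] m \<otimes> x) \<le> cnorm A (x [^] m) * cnorm A x"
    using Suc by (intro cnorm_mult) auto
  also have "\<dots> \<le> cnorm A x ^ m * cnorm A x"
    using Suc cnorm_nonneg by (intro mult_right_mono) auto
  finally show ?case by (simp add: mult.commute)
qed (simp add: norm_one_le)

text \<open>The terms of degree at least two in the binomial expansion are bounded by the same terms
  of the scalar expansion at the norm of \<open>x\<close>. In the induction, the old error is
  multiplied by 1 + x and the new quadratic term is m times the square of \<open>x\<close>.\<close>

lemma norm_pow_one_plus_le: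
  assumes x: "x \<in> carrier A"
  shows "cnorm A ((\<one> \<oplus> x) [^] (m::nat) \<ominus> (\<one> \<oplus> of_nat m \<odot> x))
    \<le> (1 + cnorm A x) ^ m - 1 - real m * cnorm A x"
proof (induction m)
  case 0
  then show ?case using x by (simp add: diff_self)
next
  case (Suc m)
  let ?r = "cnorm A x"
  let ?P = "(\<one> \<oplus> x) [^] m" and ?L = "\<one> \<oplus> of_nat m \<odot> x"
  have "cnorm A (\<one> \<oplus> x) \<le> 1 + ?r"
    using cnorm_triangle[of \<one> x] norm_one_le x by simp
  then have 1: "cnorm A (?P \<otimes> (\<one> \<oplus> x) \<ominus> ?L \<otimes> (\<one> \<oplus> x))
      \<le> ((1 + ?r) ^ m - 1 - real m * ?r) * (1 + ?r)"
    using Suc cnorm_mult[of "?P \<ominus> ?L" "\<one> \<oplus> x"] x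
      mult_mono[OF Suc \<open>cnorm A (\<one> \<oplus> x) \<le> 1 + ?r\<close>] cnorm_nonneg[of "?P \<ominus> ?L"]
      cnorm_nonneg[of "\<one> \<oplus> x"]
    by (simp add: diff_mult_left)
  have L: "?L \<otimes> (\<one> \<oplus> x) = (\<one> \<oplus> of_nat (Suc m) \<odot> x) \<oplus> of_nat m \<odot> (x \<otimes> x)"
    using x scale_add_left[of x 1 "of_nat m"]
    by (simp add: l_distr r_distr smult_mult_left a_ac)
  have 2: "cnorm A (?L \<otimes> (\<one> \<oplus> x) \<ominus> (\<one> \<oplus> of_nat (Suc m) \<odot> x)) \<le> real m * ?r\<^sup>2"
  proof -
    have "?L \<otimes> (\<one> \<oplus> x) \<ominus> (\<one> \<oplus> of_nat (Suc m) \<odot> x) = of_nat m \<odot> (x \<otimes> x)"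
      unfolding L using x by (intro add_diff_cancel) auto
    then show ?thesis
      using cnorm_mult[of x x] x by (simp add: cnorm_smult power2_eq_square mult_left_mono)
  qed
  have "cnorm A ((\<one> \<oplus> x) [^] Suc m \<ominus> (\<one> \<oplus> of_nat (Suc m) \<odot> x))
      \<le> ((1 + ?r) ^ m - 1 - real m * ?r) * (1 + ?r) + real m * ?r\<^sup>2"
    using norm_diff_triangle[of "?P \<otimes> (\<one> \<oplus> x)" "?L \<otimes> (\<one> \<oplus> x)" "\<one> \<oplus> of_nat (Suc m) \<odot> x"] 1 2 x
    by simp
  also have "\<dots> = (1 + ?r) ^ Suc m - 1 - real (Suc m) * ?r"
    by (simp add: algebra_simps power2_eq_square)
  finally show ?case .
qed

text \<open>For self-adjoint \<open>h\<close> the terms linear in \<open>h\<close> cancel in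
  \<open>star A z \<otimes> z\<close>, where z = 1 + i h/m. Its norm is thus at most 1 + 1/m, and
  the m-th power contributes at most e, which is below 4. The bound 2 is independent of
  \<open>h\<close>; only m has to grow with it.\<close>

lemma norm_exp_approx_le:
  assumes h: "h \<in> carrier A" "star A h = h" and m: "m > 0" "(cnorm A h)\<^sup>2 \<le> real m"
  shows "cnorm A ((\<one> \<oplus> (\<i> / of_nat m) \<odot> h) [^] m) \<le> 2"
proof -
  define z where "z = \<one> \<oplus> (\<i> / of_nat m) \<odot> h"
  have z: "z \<in> carrier A" "star A z = \<one> \<oplus> (- \<i> / of_nat m) \<odot> h"
    using h by (simp_all add: z_def star_add star_smult)
  have "star A z \<otimes> z = \<one> \<oplus> (((\<i> / of_nat m) \<odot> h \<oplus> (- \<i> / of_nat m) \<odot> h)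
      \<oplus> (1 / (of_nat m)\<^sup>2) \<odot> (h \<otimes> h))"
    using h unfolding z(2) unfolding z_def
    by (simp add: l_distr r_distr smult_mult_left smult_mult_right scale_scale scale_add_right a_ac
        power2_eq_square)
  also have "\<dots> = \<one> \<oplus> (1 / (of_nat m)\<^sup>2) \<odot> (h \<otimes> h)"
    using h scale_cancel[of h "\<i> / of_nat m"] by simp
  finally have "(cnorm A z)\<^sup>2 = cnorm A (\<one> \<oplus> (1 / (of_nat m)\<^sup>2) \<odot> (h \<otimes> h))"
    using cstar_identity[OF z(1)] by simp
  also have "\<dots> \<le> 1 + (1 / (real m)\<^sup>2) * (cnorm A h)\<^sup>2"
  proof -
    have "cnorm A ((1 / (of_nat m)\<^sup>2) \<odot> (h \<otimes> h)) \<le> (1 / (real m)\<^sup>2) * (cnorm A h)\<^sup>2"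
      using cnorm_mult[of h h] h
      by (simp add: cnorm_smult norm_divide norm_mult power2_eq_square divide_right_mono)
    then show ?thesis
      using cnorm_triangle[of \<one> "(1 / (of_nat m)\<^sup>2) \<odot> (h \<otimes> h)"] norm_one_le h by simp
  qed
  also have "\<dots> \<le> 1 + 1 / real m"
    using mult_left_mono[OF m(2), of "1 / (real m)\<^sup>2"] m(1) by (simp add: power2_eq_square)
  also have "\<dots> \<le> exp (1 / real m)"
    by (rule exp_ge_add_one_self)
  finally have le: "(cnorm A z)\<^sup>2 \<le> exp (1 / real m)" .
  have "(cnorm A (z [^] m))\<^sup>2 \<le> (cnorm A z ^ m)\<^sup>2"
    using norm_pow_le[OF z(1)] cnorm_nonneg z by (intro power_mono) auto
  also have "\<dots> = ((cnorm A z)\<^sup>2) ^ m"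
    by (simp add: power_mult [symmetric] mult.commute)
  also have "\<dots> \<le> exp (1 / real m) ^ m"
    using le by (intro power_mono) auto
  also have "\<dots> = exp 1"
    using m by (simp flip: exp_of_nat_mult)
  also have "\<dots> \<le> 2\<^sup>2"
    using exp_le by simp
  finally show ?thesis
    unfolding z_def using abs_le_square_iff[of "cnorm A (z [^] m)" 2] by (simp add: z_def)
qed

end

section \<open>Continuity of *-homomorphisms and closedness of their range\<close>

locale cstar_hom = A: unital_cstar_algebra A + B: unital_cstar_algebra B
  for A :: "'a cstar" (structure) and B :: "'b cstar" (structure) and \<phi> :: "'a \<Rightarrow> 'b" +
  assumes hom: "\<phi> \<in> unital_star_hom A B"
begin

lemma hom_closed [simp, intro]: "x \<in> carrier A \<Longrightarrow> \<phi> x \<in> carrier B"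
  and hom_mult [simp]: "x \<in> carrier A \<Longrightarrow> y \<in> carrier A \<Longrightarrow> \<phi> (x \<otimes> y) = \<phi> x \<otimes>\<^bsub>B\<^esub> \<phi> y"
  and hom_add [simp]: "x \<in> carrier A \<Longrightarrow> y \<in> carrier A \<Longrightarrow> \<phi> (x \<oplus> y) = \<phi> x \<oplus>\<^bsub>B\<^esub> \<phi> y"
  and hom_one [simp]: "\<phi> \<one> = \<one>\<^bsub>B\<^esub>"
  and hom_scale [simp]: "x \<in> carrier A \<Longrightarrow> \<phi> (c \<odot> x) = c \<odot>\<^bsub>B\<^esub> \<phi> x"
  and hom_star [simp]: "x \<in> carrier A \<Longrightarrow> \<phi> (star A x) = star B (\<phi> x)"
  using hom by (auto simp: unital_star_hom_def ring_hom_def)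

lemma hom_zero [simp]: "\<phi> \<zero> = \<zero>\<^bsub>B\<^esub>"
  using hom_scale[of \<zero> 0] by simp

lemma hom_diff [simp]:
  "x \<in> carrier A \<Longrightarrow> y \<in> carrier A \<Longrightarrow> \<phi> (x \<ominus> y) = \<phi> x \<ominus>\<^bsub>B\<^esub> \<phi> y"
  by (simp add: A.diff_eq_scale B.diff_eq_scale)

lemma hom_pow: "x \<in> carrier A \<Longrightarrow> \<phi> (x [^] (m::nat)) = \<phi> x [^]\<^bsub>B\<^esub> m"
  by (induction m) auto

lemma hom_finsum:
  assumes "finite I" "\<And>i. i \<in> I \<Longrightarrow> f i \<in> carrier A"
  shows "\<phi> (finsum A f I) = (\<Oplus>\<^bsub>B\<^esub>i\<in>I. \<phi> (f i))"
  using assms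
proof (induction I rule: finite_induct)
  case (insert j J)
  then have "f \<in> J \<rightarrow> carrier A" by auto
  with insert show ?case by (auto simp: A.finsum_insert B.finsum_insert Pi_def)
qed simp

lemma hom_re_part: "x \<in> carrier A \<Longrightarrow> \<phi> (A.re_part x) = B.re_part (\<phi> x)"
  by (simp add: A.re_part_def B.re_part_def)

text \<open>Scaled to norm 1/2, \<open>h\<close> is the real part of an isometry; the image of that
  isometry is again one, so its real part has norm at most 1. The factor 2 is the reciprocal of the
  1/2; the sharp constant would be 1, but continuity is all that is wanted.\<close>

lemma norm_hom_self_adjoint_le:
  assumes h: "h \<in> carrier A" "star A h = h"
  shows "cnorm B (\<phi> h) \<le> 2 * cnorm A h"
proof (cases "h = \<zero>")
  case False
  then have r: "cnorm A h > 0"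
    using A.cnorm_nonneg[OF h(1)] A.cnorm_eq_0_iff[OF h(1)] by linarith
  define t where "t = 1 / (2 * cnorm A h)"
  have "t > 0" using r by (simp add: t_def)
  define g where "g = complex_of_real t \<odot> h"
  have "cnorm A g = 1/2" "g \<in> carrier A" "star A g = g"
    using h r by (simp_all add: g_def t_def A.cnorm_smult A.star_smult norm_divide norm_mult)
  then obtain v where v: "v \<in> carrier A" "star A v \<otimes> v = \<one>" "A.re_part v = g"
    using A.re_part_of_isometry[of g] by auto
  have "star B (\<phi> v) \<otimes>\<^bsub>B\<^esub> \<phi> v = \<one>\<^bsub>B\<^esub>"
    using arg_cong[OF v(2), of \<phi>] v(1) by simp
  then have "cnorm B (\<phi> g) \<le> 1"
    using B.norm_re_part_le[of "\<phi> v"] B.norm_le_one_of_isometry[of "\<phi> v"] v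
    by (simp flip: v(3) add: hom_re_part)
  then have "t * cnorm B (\<phi> h) \<le> 1"
    using h \<open>t > 0\<close> by (simp add: g_def B.cnorm_smult)
  then show ?thesis using r by (simp add: t_def field_simps)
qed simp

text \<open>The C*-identity reduces this to the self-adjoint element
  \<open>star A x \<otimes> x\<close>; the factor that results, the square root of 2, is rounded
  up.\<close>

lemma norm_hom_le:
  assumes "x \<in> carrier A" shows "cnorm B (\<phi> x) \<le> 2 * cnorm A x"
proof -
  have "(cnorm B (\<phi> x))\<^sup>2 = cnorm B (\<phi> (star A x \<otimes> x))"
    using assms by (simp add: B.cstar_identity)
  also have "\<dots> \<le> 2 * cnorm A (star A x \<otimes> x)"
    using assms by (intro norm_hom_self_adjoint_le) (auto simp: A.star_mult)
  also have "\<dots> \<le> (2 * cnorm A x)\<^sup>2"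
    using assms by (simp add: A.cstar_identity power2_eq_square)
  finally show ?thesis
    using A.cnorm_nonneg[OF assms] power2_le_imp_le[of "cnorm B (\<phi> x)" "2 * cnorm A x"] by simp
qed

lemma hom_clim:
  assumes "A.clim s x" shows "B.clim (\<lambda>k. \<phi> (s k)) (\<phi> x)"
proof -
  note c = A.climD[OF assms]
  have "(\<lambda>k. 2 * cnorm A (s k \<ominus> x)) \<longlonglongrightarrow> 2 * 0"
    by (intro tendsto_intros c)
  then show ?thesis
    using c norm_hom_le[of "s _ \<ominus> x"]
    by (intro B.climI[where b = "\<lambda>k. 2 * cnorm A (s k \<ominus> x)"]) auto
qed

text \<open>\<open>(1 + i h/m)\<^sup>m\<close> is bounded independently of \<open>h\<close>, while its image is close to
  \<open>1 + i \<phi> h\<close> for small \<open>\<phi> h\<close>; this lifts an approximate preimage with control of the norm.\<close>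

lemma bounded_approximate_lift:
  assumes y: "y \<in> carrier B" "star B y = y"
    and approx: "\<And>e. e > 0 \<Longrightarrow> \<exists>a\<in>carrier A. cnorm B (\<phi> a \<ominus>\<^bsub>B\<^esub> y) < e"
  shows "\<exists>a\<in>carrier A. star A a = a \<and> cnorm A a \<le> 15 * cnorm B y \<and>
    cnorm B (\<phi> a \<ominus>\<^bsub>B\<^esub> y) \<le> 3/4 * cnorm B y"
proof (cases "y = \<zero>\<^bsub>B\<^esub>")
  case True
  then show ?thesis by (intro bexI[of _ \<zero>]) (auto simp: B.diff_self)
next
  case False
  define r where "r = cnorm B y"
  have r: "r > 0"
    using False B.cnorm_nonneg[OF y(1)] B.cnorm_eq_0_iff[OF y(1)] by (simp add: r_def)
  obtain a0 where a0: "a0 \<in> carrier A" "cnorm B (\<phi> a0 \<ominus>\<^bsub>B\<^esub> y) < r / 4"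
    using approx[of "r / 4"] r by auto
  define a1 where "a1 = A.re_part a0"
  have a1: "a1 \<in> carrier A" "star A a1 = a1" "cnorm B (\<phi> a1 \<ominus>\<^bsub>B\<^esub> y) \<le> r / 4"
    using a0 y B.norm_re_part_diff_le[of "\<phi> a0" y] by (simp_all add: a1_def hom_re_part)
  \<comment> \<open>The norm of \<open>a1\<close> is unknown, but that of its image is at most r +
    r/4. Division by 5 r brings the norm of \<open>\<phi> h\<close> to at most 1/4, while
    \<open>h\<close> itself may be large.\<close>
  define h where "h = complex_of_real (1 / (5 * r)) \<odot> a1"
  have h: "h \<in> carrier A" "star A h = h" "complex_of_real (5 * r) \<odot> h = a1"
    using a1 r by (simp_all add: h_def A.star_smult A.scale_scale)
  define b where "b = \<phi> h"
  have b: "b \<in> carrier B" "complex_of_real (5 * r) \<odot>\<^bsub>B\<^esub> b = \<phi> a1"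
    using h hom_scale[of h "complex_of_real (5 * r)"] by (simp_all add: b_def)
  have "cnorm B (\<phi> a1) \<le> 5 / 4 * r"
    using B.norm_le_add_diff[of "\<phi> a1" y] a1 y by (simp add: r_def)
  moreover have "cnorm B (\<phi> a1) = 5 * r * cnorm B b"
    using r b(1) by (simp flip: b(2) add: B.cnorm_smult norm_mult)
  ultimately have bn: "cnorm B b \<le> 1/4"
    using r by (simp add: field_simps)
  \<comment> \<open>Any positive m above the square of the norm of \<open>h\<close> would do;
    \<open>Suc\<close> secures positivity.\<close>
  define m where "m = Suc (nat \<lceil>(cnorm A h)\<^sup>2\<rceil>)"
  have m: "m > 0" "(cnorm A h)\<^sup>2 \<le> real m"
    by (simp_all add: m_def) linarith
  define P where "P = (\<one> \<oplus> (\<i> / of_nat m) \<odot> h) [^] m"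
  have P: "P \<in> carrier A" "cnorm A P \<le> 2"
    using A.norm_exp_approx_le[OF h(1,2) m] h by (simp_all add: P_def)
  define x where "x = (\<i> / of_nat m) \<odot>\<^bsub>B\<^esub> b"
  have x: "x \<in> carrier B" "of_nat m \<odot>\<^bsub>B\<^esub> x = \<i> \<odot>\<^bsub>B\<^esub> b" "real m * cnorm B x = cnorm B b"
    using b m by (simp_all add: x_def B.scale_scale B.cnorm_smult norm_divide)
  have "\<phi> P = (\<one>\<^bsub>B\<^esub> \<oplus>\<^bsub>B\<^esub> x) [^]\<^bsub>B\<^esub> m"
    using h by (simp add: P_def hom_pow x_def b_def)
  then have "cnorm B (\<phi> P \<ominus>\<^bsub>B\<^esub> (\<one>\<^bsub>B\<^esub> \<oplus>\<^bsub>B\<^esub> \<i> \<odot>\<^bsub>B\<^esub> b)) \<le> (1 + cnorm B x) ^ m - 1 - cnorm B b"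
    using B.norm_pow_one_plus_le[of x m] x by simp
  also have "\<dots> \<le> exp (cnorm B b) - 1 - cnorm B b"
  proof -
    have "(1 + cnorm B x) ^ m \<le> exp (cnorm B x) ^ m"
      using B.cnorm_nonneg[OF x(1)] by (intro power_mono exp_ge_add_one_self) auto
    then show ?thesis
      by (simp flip: exp_of_nat_mult add: x)
  qed
  also have "\<dots> \<le> (cnorm B b)\<^sup>2"
    using exp_bound[of "cnorm B b"] bn B.cnorm_nonneg[OF b(1)] by simp
  also have "\<dots> \<le> (1/4)\<^sup>2"
    using bn B.cnorm_nonneg[OF b(1)] by (intro power_mono) auto
  finally have Pb: "cnorm B (\<phi> P \<ominus>\<^bsub>B\<^esub> (\<one>\<^bsub>B\<^esub> \<oplus>\<^bsub>B\<^esub> \<i> \<odot>\<^bsub>B\<^esub> b)) \<le> 1/16"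
    by (simp add: power2_eq_square)
  \<comment> \<open>Since \<open>\<phi> P\<close> is close to 1 + i b, solving for b gives this
    lift; its norm is at most 2 + 1.\<close>
  define a2 where "a2 = (- \<i>) \<odot> (P \<ominus> \<one>)"
  have a2: "a2 \<in> carrier A" "cnorm A a2 \<le> 3"
    using P A.cnorm_triangle[of P "(-1) \<odot> \<one>"] A.norm_one_le
    by (simp_all add: a2_def A.cnorm_smult A.diff_eq_scale)
  have "\<phi> a2 \<ominus>\<^bsub>B\<^esub> b = (- \<i>) \<odot>\<^bsub>B\<^esub> (\<phi> P \<ominus>\<^bsub>B\<^esub> (\<one>\<^bsub>B\<^esub> \<oplus>\<^bsub>B\<^esub> \<i> \<odot>\<^bsub>B\<^esub> b))"
    using P b by (simp add: a2_def B.diff_eq_scale B.scale_add_right B.scale_scale B.a_ac)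
  then have a2b: "cnorm B (\<phi> a2 \<ominus>\<^bsub>B\<^esub> b) \<le> 1/16"
    using Pb P b by (simp add: B.cnorm_smult)
  define a3 where "a3 = A.re_part a2"
  have a3: "a3 \<in> carrier A" "star A a3 = a3" "cnorm A a3 \<le> 3"
    using a2 A.norm_re_part_le[of a2] by (simp_all add: a3_def)
  have sb: "star B b = b"
    using h hom_star[of h] by (simp add: b_def)
  have a3b: "cnorm B (\<phi> a3 \<ominus>\<^bsub>B\<^esub> b) \<le> 1/16"
    using a2 a2b b(1) sb B.norm_re_part_diff_le[of "\<phi> a2" b] by (simp add: a3_def hom_re_part)
  define a where "a = complex_of_real (5 * r) \<odot> a3"
  have "cnorm B (\<phi> a \<ominus>\<^bsub>B\<^esub> \<phi> a1) = 5 * r * cnorm B (\<phi> a3 \<ominus>\<^bsub>B\<^esub> b)"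
    using a3 b(1) r unfolding b(2)[symmetric]
    by (simp add: a_def B.norm_diff_scale norm_mult del: of_real_mult)
  also have "\<dots> \<le> 5 * r * (1/16)"
    using a3b r by (intro mult_left_mono) auto
  \<comment> \<open>The errors r/4 of \<open>a1\<close> and 5 r/16 of the lift add up to 9 r/16. The
    norm bound 15 r below is the scaling 5 r times 3.\<close>
  finally have "cnorm B (\<phi> a \<ominus>\<^bsub>B\<^esub> y) \<le> 3/4 * r"
    using B.norm_diff_triangle[of "\<phi> a" "\<phi> a1" y] a1 a3 y r by (simp add: a_def)
  moreover have "cnorm A a \<le> 15 * r"
    using a3 r by (simp add: a_def A.cnorm_smult norm_mult)
  ultimately show ?thesis
    using a3 by (intro bexI[of _ a]) (auto simp: a_def r_def A.star_smult)
qed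

text \<open>Successive approximation, as in the proof of the open mapping theorem: each round lifts
  the remaining defect with control of the norm, the defect shrinks by 3/4, and the corrections sum
  to an exact preimage.\<close>

lemma self_adjoint_limit_in_image:
  assumes y: "y \<in> carrier B" "star B y = y"
    and approx: "\<And>e. e > 0 \<Longrightarrow> \<exists>a\<in>carrier A. cnorm B (\<phi> a \<ominus>\<^bsub>B\<^esub> y) < e"
  shows "y \<in> \<phi> ` carrier A"
proof -
  define r where "r = cnorm B y"
  have "\<exists>s. \<forall>k. (s k \<in> carrier A \<and> star A (s k) = s k \<and> cnorm B (\<phi> (s k) \<ominus>\<^bsub>B\<^esub> y) \<le> r * (3/4) ^ k) \<and>
    cnorm A (s (Suc k) \<ominus> s k) \<le> 15 * r * (3/4) ^ k"
  proof (rule dependent_nat_choice)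
    show "\<exists>a. a \<in> carrier A \<and> star A a = a \<and> cnorm B (\<phi> a \<ominus>\<^bsub>B\<^esub> y) \<le> r * (3/4) ^ 0"
      using y by (intro exI[of _ \<zero>]) (auto simp: B.norm_diff_commute[of _ y] r_def B.minus_eq)
  next
    fix a k
    assume a: "a \<in> carrier A \<and> star A a = a \<and> cnorm B (\<phi> a \<ominus>\<^bsub>B\<^esub> y) \<le> r * (3/4) ^ k"
    define y' where "y' = y \<ominus>\<^bsub>B\<^esub> \<phi> a"
    have y': "y' \<in> carrier B" "star B y' = y'" "cnorm B y' \<le> r * (3/4) ^ k"
      using a y hom_star[of a] by (auto simp: y'_def B.star_diff B.norm_diff_commute[of y])
    \<comment> \<open>Approximating the defect \<open>y'\<close> by the image of c is the same as
      approximating \<open>y\<close> by the image of c + a. Read in both directions, this makes the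
      defect approximable and turns its lift into the next iterate.\<close>
    have swap: "\<phi> c \<ominus>\<^bsub>B\<^esub> y' = \<phi> (c \<oplus> a) \<ominus>\<^bsub>B\<^esub> y" if "c \<in> carrier A" for c
      using that a y by (simp add: y'_def B.minus_eq B.minus_add B.a_ac)
    have "\<exists>c\<in>carrier A. cnorm B (\<phi> c \<ominus>\<^bsub>B\<^esub> y') < e" if "e > 0" for e
    proof -
      obtain c where c: "c \<in> carrier A" "cnorm B (\<phi> c \<ominus>\<^bsub>B\<^esub> y) < e"
        using approx[OF \<open>e > 0\<close>] by auto
      have "(c \<ominus> a) \<oplus> a = c"
        using c a by (simp add: A.minus_eq A.a_assoc A.l_neg)
      then show ?thesis
        using swap[of "c \<ominus> a"] c a by (intro bexI[of _ "c \<ominus> a"]) auto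
    qed
    then obtain c where c: "c \<in> carrier A" "star A c = c" "cnorm A c \<le> 15 * cnorm B y'"
      "cnorm B (\<phi> c \<ominus>\<^bsub>B\<^esub> y') \<le> 3/4 * cnorm B y'"
      using bounded_approximate_lift[OF y'(1,2)] by blast
    have "(c \<oplus> a) \<ominus> a = c"
      using c a by (simp add: A.minus_eq A.a_assoc A.r_neg)
    then show "\<exists>a'. (a' \<in> carrier A \<and> star A a' = a' \<and> cnorm B (\<phi> a' \<ominus>\<^bsub>B\<^esub> y) \<le> r * (3/4) ^ Suc k) \<and>
        cnorm A (a' \<ominus> a) \<le> 15 * r * (3/4) ^ k"
      using c a y'(3) swap[OF c(1)] by (intro exI[of _ "c \<oplus> a"]) (auto simp: A.star_add)
  qed
  then obtain s where s: "\<And>k. s k \<in> carrier A" "\<And>k. cnorm B (\<phi> (s k) \<ominus>\<^bsub>B\<^esub> y) \<le> r * (3/4) ^ k"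
    "\<And>k. cnorm A (s (Suc k) \<ominus> s k) \<le> 15 * r * (3/4) ^ k"
    by blast
  obtain x where x: "A.clim s x"
    using A.geometric_clim[OF s(1) _ _ s(3)] by auto
  have "(\<lambda>k. r * (3/4) ^ k) \<longlonglongrightarrow> r * 0"
    by (intro tendsto_intros LIMSEQ_realpow_zero) auto
  then have "B.clim (\<lambda>k. \<phi> (s k)) y"
    using s y by (intro B.climI[where b = "\<lambda>k. r * (3/4) ^ k"]) auto
  then have "y = \<phi> x"
    using B.clim_unique hom_clim[OF x] by blast
  then show ?thesis
    using A.climD[OF x] by blast
qed

text \<open>The self-adjoint case is applied to the real parts of y and i y, which are limits of
  images of real parts.\<close>

lemma norm_closed_image: "norm_closed B (\<phi> ` carrier A)"
proof (rule B.norm_closedI)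
  fix s y assume s: "B.clim s y" "range s \<subseteq> \<phi> ` carrier A"
  note c = B.climD[OF s(1)]
  have "\<forall>k. \<exists>a. a \<in> carrier A \<and> s k = \<phi> a" using s(2) by blast
  then obtain a where a: "\<And>k. a k \<in> carrier A" "\<And>k. s k = \<phi> (a k)"
    by metis
  have key: "z \<in> \<phi> ` carrier A"
    if z: "star B z = z" "B.clim (\<lambda>k. \<phi> (f k)) z" "\<And>k. f k \<in> carrier A" for f z
  proof (rule self_adjoint_limit_in_image)
    fix e :: real assume "e > 0"
    then have "\<forall>\<^sub>F k in sequentially. cnorm B (\<phi> (f k) \<ominus>\<^bsub>B\<^esub> z) < e"
      using order_tendstoD(2)[OF B.climD(3)[OF z(2)]] by blast
    then show "\<exists>a\<in>carrier A. cnorm B (\<phi> a \<ominus>\<^bsub>B\<^esub> z) < e"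
      using z(3) by (auto simp: eventually_sequentially)
  qed (use z B.climD[OF z(2)] in auto)
  have re: "B.re_part z \<in> \<phi> ` carrier A"
    if z: "B.clim (\<lambda>k. \<phi> (f k)) z" "\<And>k. f k \<in> carrier A" for f z
  proof (rule key[of _ "\<lambda>k. A.re_part (f k)"])
    show "B.clim (\<lambda>k. \<phi> (A.re_part (f k))) (B.re_part z)"
      using B.clim_scale[OF tendsto_const B.clim_add[OF z(1) B.clim_star[OF z(1)]]] z
      by (simp add: hom_re_part B.re_part_def)
  qed (use z B.climD[OF z(1)] in auto)
  have "B.re_part y \<in> \<phi> ` carrier A"
    using re[of a y] s(1) a(1) by (simp flip: a(2))
  then obtain a1 where a1: "a1 \<in> carrier A" "B.re_part y = \<phi> a1" by blast
  have "B.re_part (\<i> \<odot>\<^bsub>B\<^esub> y) \<in> \<phi> ` carrier A"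
    using re[of "\<lambda>k. \<i> \<odot> a k" "\<i> \<odot>\<^bsub>B\<^esub> y"] B.clim_scale[OF tendsto_const s(1)] a(1)
    by (simp flip: a(2))
  then obtain a2 where a2: "a2 \<in> carrier A" "B.re_part (\<i> \<odot>\<^bsub>B\<^esub> y) = \<phi> a2" by blast
  \<comment> \<open>The decomposition used is y = Re y - i Re (i y).\<close>
  have "\<phi> (a1 \<oplus> (- \<i>) \<odot> a2) = ((1/2) \<odot>\<^bsub>B\<^esub> y \<oplus>\<^bsub>B\<^esub> (1/2) \<odot>\<^bsub>B\<^esub> y)
      \<oplus>\<^bsub>B\<^esub> ((1/2) \<odot>\<^bsub>B\<^esub> star B y \<oplus>\<^bsub>B\<^esub> (-1/2) \<odot>\<^bsub>B\<^esub> star B y)"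
    using c a1(1) a2(1)
    by (simp flip: a1(2) a2(2) add: B.re_part_def B.scale_add_right B.scale_scale B.star_smult B.a_ac)
  also have "\<dots> = y"
    using c B.scale_add_left[of y "1/2" "1/2"] B.scale_add_left[of "star B y" "1/2" "-1/2"] by simp
  finally show "y \<in> \<phi> ` carrier A"
    using a1 a2 by (metis A.a_closed A.scale_closed imageI)
qed auto

lemma image_eq_carrier:
  assumes "cstar_generates B G" "G \<subseteq> \<phi> ` carrier A"
  shows "\<phi> ` carrier A = carrier B"
proof -
  have "unital_cstar_subalgebra B (\<phi> ` carrier A)"
    unfolding unital_cstar_subalgebra_def lin_subspace_def
  proof (intro conjI ballI allI norm_closed_image)
    show "\<zero>\<^bsub>B\<^esub> \<in> \<phi> ` carrier A" "\<one>\<^bsub>B\<^esub> \<in> \<phi> ` carrier A"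
      by (metis A.zero_closed hom_zero imageI, metis A.one_closed hom_one imageI)
  qed (auto simp flip: hom_add hom_mult hom_scale hom_star)
  then show ?thesis
    using assms by (auto simp: cstar_generates_def)
qed

end

section \<open>Universal properties in arbitrary types\<close>

definition transport :: "'a cstar \<Rightarrow> 'a set \<Rightarrow> ('a \<Rightarrow> 'b) \<Rightarrow> 'b cstar" where
  "transport A S f = (let g = inv_into S f in
    \<lparr>carrier = f ` S, monoid.mult = (\<lambda>x y. f (g x \<otimes>\<^bsub>A\<^esub> g y)), one = f \<one>\<^bsub>A\<^esub>,
     ring.zero = f \<zero>\<^bsub>A\<^esub>, add = (\<lambda>x y. f (g x \<oplus>\<^bsub>A\<^esub> g y)), smult = (\<lambda>c x. f (c \<odot>\<^bsub>A\<^esub> g x)),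
     star = (\<lambda>x. f (star A (g x))), cnorm = (\<lambda>x. cnorm A (g x))\<rparr>)"

context unital_cstar_algebra
begin

context
  fixes S :: "'a set" and f :: "'a \<Rightarrow> 'b"
  assumes S: "unital_cstar_subalgebra A S" and inj: "inj_on f S"
begin

lemma subalgebra_closed:
  "x \<in> S \<Longrightarrow> x \<in> carrier A" "\<zero> \<in> S" "\<one> \<in> S"
  "x \<in> S \<Longrightarrow> y \<in> S \<Longrightarrow> x \<oplus> y \<in> S" "x \<in> S \<Longrightarrow> y \<in> S \<Longrightarrow> x \<otimes> y \<in> S"
  "x \<in> S \<Longrightarrow> c \<odot> x \<in> S" "x \<in> S \<Longrightarrow> star A x \<in> S"
  using S by (auto simp: unital_cstar_subalgebra_def lin_subspace_def)

lemma subalgebra_diff_closed: "x \<in> S \<Longrightarrow> y \<in> S \<Longrightarrow> x \<ominus> y \<in> S"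
  by (simp add: diff_eq_scale subalgebra_closed)

lemma transport_simps:
  "carrier (transport A S f) = f ` S"
  "\<one>\<^bsub>transport A S f\<^esub> = f \<one>" "\<zero>\<^bsub>transport A S f\<^esub> = f \<zero>"
  "x \<in> S \<Longrightarrow> y \<in> S \<Longrightarrow> f x \<otimes>\<^bsub>transport A S f\<^esub> f y = f (x \<otimes> y)"
  "x \<in> S \<Longrightarrow> y \<in> S \<Longrightarrow> f x \<oplus>\<^bsub>transport A S f\<^esub> f y = f (x \<oplus> y)"
  "x \<in> S \<Longrightarrow> c \<odot>\<^bsub>transport A S f\<^esub> f x = f (c \<odot> x)"
  "x \<in> S \<Longrightarrow> star (transport A S f) (f x) = f (star A x)"
  "x \<in> S \<Longrightarrow> cnorm (transport A S f) (f x) = cnorm A x"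
  using inj by (simp_all add: transport_def Let_def)

lemma abelian_group_transport: "abelian_group (transport A S f)"
proof (rule abelian_groupI)
  fix x assume "x \<in> carrier (transport A S f)"
  then obtain a where a: "a \<in> S" "x = f a" by (auto simp: transport_simps)
  then have "(-1) \<odot> a \<oplus> a = \<zero>"
    by (simp add: subalgebra_closed l_neg flip: minus_eq_scale)
  then show "\<exists>y\<in>carrier (transport A S f). y \<oplus>\<^bsub>transport A S f\<^esub> x = \<zero>\<^bsub>transport A S f\<^esub>"
    using a by (intro bexI[of _ "f ((-1) \<odot> a)"]) (auto simp: transport_simps subalgebra_closed)
qed (auto simp: transport_simps subalgebra_closed a_ac)

lemma ring_transport: "ring (transport A S f)"
proof (rule ringI[OF abelian_group_transport])
  show "monoid (transport A S f)"
    by (rule monoidI) (auto simp: transport_simps subalgebra_closed m_assoc)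
qed (auto simp: transport_simps subalgebra_closed l_distr r_distr)

text \<open>Subtraction is derived from the additive inverse, so it has to be identified before
  distances can be compared.\<close>

lemma transport_diff:
  assumes "x \<in> S" "y \<in> S"
  shows "f x \<ominus>\<^bsub>transport A S f\<^esub> f y = f (x \<ominus> y)"
proof -
  interpret T: ring "transport A S f" by (rule ring_transport)
  have "(-1) \<odot> y \<oplus> y = \<zero>"
    using assms by (simp add: subalgebra_closed l_neg flip: minus_eq_scale)
  then have "\<ominus>\<^bsub>transport A S f\<^esub> f y = f ((-1) \<odot> y)"
    using assms by (intro T.minus_equality) (auto simp: transport_simps subalgebra_closed)
  then show ?thesis
    using assms by (simp add: T.minus_eq transport_simps subalgebra_closed diff_eq_scale)
qed

lemma unital_cstar_algebra_transport: "unital_cstar_algebra (transport A S f)"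
proof -
  let ?T = "transport A S f"
  interpret T: ring ?T by (rule ring_transport)
  have mod: "module (ring_of_type_algebra :: complex ring) ?T"
    by (rule moduleI[OF _ abelian_group_transport])
      (auto simp: cring_from_type_algebra transport_simps subalgebra_closed ring_of_type_algebra_sel
        scale_add_left scale_add_right scale_scale)
  show ?thesis
  proof (intro unital_cstar_algebra.intro[OF mod T.ring_axioms] unital_cstar_algebra_axioms.intro)
    fix x assume "x \<in> carrier ?T"
    then obtain a where a: "a \<in> S" "x = f a" by (auto simp: transport_simps)
    then show "(cnorm ?T x = 0) = (x = \<zero>\<^bsub>?T\<^esub>)"
      using inj_on_eq_iff[OF inj, of a \<zero>] by (simp add: transport_simps subalgebra_closed cnorm_eq_0_iff)
  next
    fix s :: "nat \<Rightarrow> 'b"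
    assume s: "range s \<subseteq> carrier ?T"
      and cauchy: "\<And>e. e > 0 \<Longrightarrow> \<exists>N. \<forall>k\<ge>N. \<forall>l\<ge>N. cnorm ?T (s k \<ominus>\<^bsub>?T\<^esub> s l) < e"
    have "\<forall>k. \<exists>a. a \<in> S \<and> s k = f a" using s by (auto simp: transport_simps)
    then obtain a where a: "\<And>k. a k \<in> S" "\<And>k. s k = f (a k)" by metis
    have norm: "cnorm ?T (f b \<ominus>\<^bsub>?T\<^esub> f c) = cnorm A (b \<ominus> c)" if "b \<in> S" "c \<in> S" for b c
      using that by (simp add: transport_diff transport_simps subalgebra_diff_closed)
    have "\<exists>b\<in>carrier A. (\<lambda>k. cnorm A (a k \<ominus> b)) \<longlonglongrightarrow> 0"
      using cauchy a by (intro complete) (auto simp: norm subalgebra_closed)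
    then obtain b where b: "clim a b"
      unfolding clim_def using a subalgebra_closed(1) by blast
    \<comment> \<open>The limit exists in the ambient algebra; norm closedness of \<open>S\<close>
      places it in the part that is copied.\<close>
    then have "b \<in> S"
      using norm_closedD[of S a b] S a(1) by (auto simp: unital_cstar_subalgebra_def)
    then show "\<exists>x\<in>carrier ?T. (\<lambda>k. cnorm ?T (s k \<ominus>\<^bsub>?T\<^esub> x)) \<longlonglongrightarrow> 0"
      using climD(3)[OF b] a by (intro bexI[of _ "f b"]) (auto simp: norm transport_simps)
  qed (auto simp: transport_simps subalgebra_closed smult_mult_left smult_mult_right star_add
      star_smult star_mult cnorm_nonneg cnorm_smult cnorm_triangle cnorm_mult cstar_identity)
qed

lemma inv_transport_hom: "inv_into S f \<in> unital_star_hom (transport A S f) A"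
  unfolding unital_star_hom_def ring_hom_def
  using inj by (auto simp: transport_simps subalgebra_closed)

end

end

section \<open>Countably generated subalgebras\<close>

datatype star_expr = Gen nat | One | Add star_expr star_expr | Mult star_expr star_expr
  | Star star_expr | Scale rat rat star_expr

instance star_expr :: countable
  by countable_datatype

lemma rational_sequence: "\<exists>p :: nat \<Rightarrow> rat. (\<lambda>k. real_of_rat (p k)) \<longlonglongrightarrow> r"
proof -
  have "\<forall>k. \<exists>q. r < real_of_rat q \<and> real_of_rat q < r + inverse (real (Suc k))"
    by (intro allI of_rat_dense) simp
  then obtain p where p: "\<And>k. r < real_of_rat (p k)"
      "\<And>k. real_of_rat (p k) < r + inverse (real (Suc k))"
    by metis
  have "(\<lambda>k. r + inverse (real (Suc k))) \<longlonglongrightarrow> r + 0"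
    by (intro tendsto_intros LIMSEQ_inverse_real_of_nat)
  then have "(\<lambda>k. r + inverse (real (Suc k))) \<longlonglongrightarrow> r" by simp
  then have "(\<lambda>k. real_of_rat (p k)) \<longlonglongrightarrow> r"
    by (rule tendsto_sandwich[OF always_eventually always_eventually tendsto_const, rotated 2])
      (intro allI less_imp_le p)+
  then show ?thesis by blast
qed

context unital_cstar_algebra
begin

text \<open>Coefficients are restricted to p + i q with rational p and q, which keeps the
  expressions countable; the other scalars are recovered as limits.\<close>

primrec eval_expr :: "(nat \<Rightarrow> 'a) \<Rightarrow> star_expr \<Rightarrow> 'a" where
  "eval_expr g (Gen m) = g m"
| "eval_expr g One = \<one>"
| "eval_expr g (Add d e) = eval_expr g d \<oplus> eval_expr g e"
| "eval_expr g (Mult d e) = eval_expr g d \<otimes> eval_expr g e"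
| "eval_expr g (Star e) = star A (eval_expr g e)"
| "eval_expr g (Scale p q e) = Complex (of_rat p) (of_rat q) \<odot> eval_expr g e"

text \<open>Limits of expression sequences are used instead of a smallest closed subalgebra, because
  an element is then determined by a sequence of countable codes.\<close>

definition expr_closure :: "(nat \<Rightarrow> 'a) \<Rightarrow> 'a set" where
  "expr_closure g = {x. \<exists>e. clim (\<lambda>k. eval_expr g (e k)) x}"

lemma eval_expr_closed: "range g \<subseteq> carrier A \<Longrightarrow> eval_expr g e \<in> carrier A"
  by (induction e) auto

lemma eval_expr_in_closure: "range g \<subseteq> carrier A \<Longrightarrow> eval_expr g e \<in> expr_closure g"
  unfolding expr_closure_def by (intro CollectI exI[of _ "\<lambda>_. e"] clim_const eval_expr_closed)

text \<open>A diagonal choice: the k-th element of the sequence is replaced by an expression within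
  1/(k+1) of it.\<close>

lemma expr_closure_norm_closed:
  assumes g: "range g \<subseteq> carrier A" shows "norm_closed A (expr_closure g)"
proof (rule norm_closedI)
  show "expr_closure g \<subseteq> carrier A"
    using climD by (auto simp: expr_closure_def)
  fix s x assume s: "clim s x" "range s \<subseteq> expr_closure g"
  note c = climD[OF s(1)]
  have "\<forall>k. \<exists>e. cnorm A (eval_expr g e \<ominus> s k) < inverse (real (Suc k))"
  proof
    fix k
    obtain e where e: "clim (\<lambda>m. eval_expr g (e m)) (s k)"
      using s(2) by (auto simp: expr_closure_def)
    have "\<forall>\<^sub>F m in sequentially. cnorm A (eval_expr g (e m) \<ominus> s k) < inverse (real (Suc k))"
      using order_tendstoD(2)[OF climD(3)[OF e]] by simp
    then show "\<exists>e. cnorm A (eval_expr g e \<ominus> s k) < inverse (real (Suc k))"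
      by (auto simp: eventually_sequentially)
  qed
  then obtain e where e: "\<And>k. cnorm A (eval_expr g (e k) \<ominus> s k) < inverse (real (Suc k))"
    by metis
  have "clim (\<lambda>k. eval_expr g (e k)) x"
  proof (rule climI)
    show "cnorm A (eval_expr g (e k) \<ominus> x) \<le> inverse (real (Suc k)) + cnorm A (s k \<ominus> x)" for k
      using norm_diff_triangle[of "eval_expr g (e k)" "s k" x] e[of k] eval_expr_closed[OF g] c
      by (smt (verit))
    show "(\<lambda>k. inverse (real (Suc k)) + cnorm A (s k \<ominus> x)) \<longlonglongrightarrow> 0"
      using tendsto_add[OF LIMSEQ_inverse_real_of_nat c(3)] by simp
  qed (use c eval_expr_closed[OF g] in auto)
  then show "x \<in> expr_closure g"
    by (auto simp: expr_closure_def)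
qed

lemma expr_closure_subalgebra:
  assumes g: "range g \<subseteq> carrier A" shows "unital_cstar_subalgebra A (expr_closure g)"
  unfolding unital_cstar_subalgebra_def lin_subspace_def
proof (intro conjI ballI allI expr_closure_norm_closed[OF g])
  show "expr_closure g \<subseteq> carrier A"
    using climD by (auto simp: expr_closure_def)
  show "\<one> \<in> expr_closure g"
    using eval_expr_in_closure[OF g, of One] by simp
  show "\<zero> \<in> expr_closure g"
    using eval_expr_in_closure[OF g, of "Scale 0 0 One"] by (simp flip: zero_complex.code)
  fix x assume "x \<in> expr_closure g"
  then obtain d where d: "clim (\<lambda>k. eval_expr g (d k)) x" by (auto simp: expr_closure_def)
  show "star A x \<in> expr_closure g"
    using clim_star[OF d] unfolding expr_closure_def
    by (intro CollectI exI[of _ "\<lambda>k. Star (d k)"]) simp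
  show "c \<odot> x \<in> expr_closure g" for c
  proof -
    obtain p q :: "nat \<Rightarrow> rat" where "(\<lambda>k. of_rat (p k)) \<longlonglongrightarrow> Re c" "(\<lambda>k. of_rat (q k)) \<longlonglongrightarrow> Im c"
      using rational_sequence by blast
    then have "(\<lambda>k. Complex (of_rat (p k)) (of_rat (q k))) \<longlonglongrightarrow> c"
      using tendsto_Complex by fastforce
    from clim_scale[OF this d] show ?thesis
      unfolding expr_closure_def by (intro CollectI exI[of _ "\<lambda>k. Scale (p k) (q k) (d k)"]) simp
  qed
  fix y assume "y \<in> expr_closure g"
  then obtain e where e: "clim (\<lambda>k. eval_expr g (e k)) y" by (auto simp: expr_closure_def)
  show "x \<oplus> y \<in> expr_closure g"
    using clim_add[OF d e] unfolding expr_closure_def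
    by (intro CollectI exI[of _ "\<lambda>k. Add (d k) (e k)"]) simp
  show "x \<otimes> y \<in> expr_closure g"
    using clim_mult[OF d e] unfolding expr_closure_def
    by (intro CollectI exI[of _ "\<lambda>k. Mult (d k) (e k)"]) simp
qed

text \<open>Each element is sent to the codes of one chosen sequence of expressions converging to
  it; uniqueness of limits recovers the element.\<close>

lemma inj_on_expr_closure: "\<exists>f :: 'a \<Rightarrow> nat \<Rightarrow> nat. inj_on f (expr_closure g)"
proof -
  have "\<forall>x\<in>expr_closure g. \<exists>e. clim (\<lambda>k. eval_expr g (e k)) x"
    by (auto simp: expr_closure_def)
  then obtain e where e: "\<And>x. x \<in> expr_closure g \<Longrightarrow> clim (\<lambda>k. eval_expr g (e x k)) x"
    by metis
  have "inj_on (\<lambda>x k. to_nat (e x k)) (expr_closure g)"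
  proof (rule inj_onI)
    fix x y
    assume xy: "x \<in> expr_closure g" "y \<in> expr_closure g"
      and eq: "(\<lambda>k. to_nat (e x k)) = (\<lambda>k. to_nat (e y k))"
    have "e x k = e y k" for k
      using fun_cong[OF eq, of k] by simp
    then have "e x = e y" by blast
    then show "x = y"
      using clim_unique[OF e[OF xy(1)]] e[OF xy(2)] by simp
  qed
  then show ?thesis by blast
qed

text \<open>A closure of countably many *-polynomials injects into \<^typ>\<open>nat \<Rightarrow> nat\<close>, so the
  universal properties extend from that type to all others.\<close>

lemma countably_generated_copy:
  fixes g :: "nat \<Rightarrow> 'a"
  assumes g: "range g \<subseteq> carrier A"
  shows "\<exists>(C :: (nat \<Rightarrow> nat) cstar) \<psi>. cstar_hom C A \<psi> \<and> inj_on \<psi> (carrier C) \<and>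
    range g \<subseteq> \<psi> ` carrier C"
proof -
  let ?S = "expr_closure g"
  obtain f :: "'a \<Rightarrow> nat \<Rightarrow> nat" where f: "inj_on f ?S"
    using inj_on_expr_closure by blast
  note S = expr_closure_subalgebra[OF g]
  have "cstar_hom (transport A ?S f) A (inv_into ?S f)"
    using unital_cstar_algebra_transport[OF S f] inv_transport_hom[OF S f]
    by (intro cstar_hom.intro cstar_hom_axioms.intro unital_cstar_algebra_axioms)
  moreover have "inj_on (inv_into ?S f) (carrier (transport A ?S f))"
    using f by (auto simp: transport_simps[OF S f] intro: inj_onI)
  moreover have "range g \<subseteq> inv_into ?S f ` carrier (transport A ?S f)"
  proof
    fix x assume "x \<in> range g"
    then have "x \<in> ?S" using eval_expr_in_closure[OF g, of "Gen _"] by auto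
    then show "x \<in> inv_into ?S f ` carrier (transport A ?S f)"
      using f by (force simp: transport_simps[OF S f])
  qed
  ultimately show ?thesis by blast
qed

lemma matrix_copy:
  assumes v: "matrix_over n A v"
  obtains C :: "(nat \<Rightarrow> nat) cstar" and \<psi> w where "cstar_hom C A \<psi>" "inj_on \<psi> (carrier C)"
    "matrix_over n C w" "\<forall>i\<in>{1..n}. \<forall>j\<in>{1..n}. \<psi> (w i j) = v i j"
proof -
  \<comment> \<open>Positions outside the matrix are filled with \<open>\<zero>\<close>, so that the
    entries form a total sequence in the carrier.\<close>
  define g where "g m = (case prod_decode m of (i, j) \<Rightarrow>
    if i \<in> {1..n} \<and> j \<in> {1..n} then v i j else \<zero>)" for m
  have "range g \<subseteq> carrier A"
    using v by (auto simp: g_def matrix_over_def split: prod.splits)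
  then obtain C :: "(nat \<Rightarrow> nat) cstar" and \<psi>
    where C: "cstar_hom C A \<psi>" "inj_on \<psi> (carrier C)" "range g \<subseteq> \<psi> ` carrier C"
    using countably_generated_copy by blast
  have "\<exists>c\<in>carrier C. \<psi> c = v i j" if "i \<in> {1..n}" "j \<in> {1..n}" for i j
  proof -
    have "g (prod_encode (i, j)) = v i j"
      using that by (simp add: g_def)
    then show ?thesis using C(3) by (metis imageE rangeI subsetD)
  qed
  then have "\<forall>i j. \<exists>c. i \<in> {1..n} \<and> j \<in> {1..n} \<longrightarrow> c \<in> carrier C \<and> \<psi> c = v i j"
    by blast
  then obtain w where "\<And>i j. i \<in> {1..n} \<and> j \<in> {1..n} \<longrightarrow> w i j \<in> carrier C \<and> \<psi> (w i j) = v i j"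
    by metis
  then show ?thesis
    using C that[of C \<psi> w] by (auto simp: matrix_over_def)
qed

end

section \<open>The relations and the universal properties for targets of any type\<close>

lemma eps_relations_transpose:
  "eps_relations n \<epsilon> A u \<Longrightarrow> eps_relations n \<epsilon> A (\<lambda>i j. u j i)"
  unfolding eps_relations_def by blast

text \<open>Row orthogonality is column orthogonality of the transpose, and transposing only
  exchanges the two vanishing conditions. Everything about the larger set of relations can thus be
  obtained by using the smaller one twice.\<close>

lemma O_relations_iff:
  "O_relations n \<epsilon> A u \<longleftrightarrow> X_relations n \<epsilon> A u \<and> X_relations n \<epsilon> A (\<lambda>i j. u j i)"
  using eps_relations_transpose[of n \<epsilon> A u]
  by (auto simp: O_relations_def X_relations_def matrix_over_def)

text \<open>Each relation is an equation between *-polynomials, which an injective homomorphism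
  reflects. This places the relations on the copied generators.\<close>

lemma (in cstar_hom) X_relations_reflect:
  assumes inj: "inj_on \<phi> (carrier A)" and w: "matrix_over n A w"
    and \<phi>w: "\<forall>i\<in>{1..n}. \<forall>j\<in>{1..n}. \<phi> (w i j) = v i j" and X: "X_relations n \<epsilon> B v"
  shows "X_relations n \<epsilon> A w"
proof -
  have wc: "w i j \<in> carrier A" if "i \<in> {1..n}" "j \<in> {1..n}" for i j
    using w that by (simp add: matrix_over_def)
  note eq = inj_onD[OF inj]
  show ?thesis
    unfolding X_relations_def
  proof (intro conjI ballI w)
    fix i j assume ij: "i \<in> {1..n}" "j \<in> {1..n}"
    show "star A (w i j) = w i j"
      using X ij wc[OF ij] by (intro eq) (auto simp: \<phi>w X_relations_def)
    have "\<phi> (\<Oplus>k\<in>{1..n}. w k i \<otimes> w k j) = (\<Oplus>\<^bsub>B\<^esub>k\<in>{1..n}. \<phi> (w k i \<otimes> w k j))"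
      using ij wc by (intro hom_finsum) auto
    also have "\<dots> = (\<Oplus>\<^bsub>B\<^esub>k\<in>{1..n}. v k i \<otimes>\<^bsub>B\<^esub> v k j)"
    proof (rule B.finsum_cong')
      show "\<phi> (w k i \<otimes> w k j) = v k i \<otimes>\<^bsub>B\<^esub> v k j" if "k \<in> {1..n}" for k
        using ij wc that by (simp add: \<phi>w)
      show "(\<lambda>k. v k i \<otimes>\<^bsub>B\<^esub> v k j) \<in> {1..n} \<rightarrow> carrier B"
        using ij X by (auto simp: X_relations_def matrix_over_def)
    qed simp
    also have "\<dots> = delta B i j"
      using X ij by (simp add: X_relations_def)
    also have "\<dots> = \<phi> (delta A i j)"
      by (simp add: delta_def)
    finally show "(\<Oplus>k\<in>{1..n}. w k i \<otimes> w k j) = delta A i j"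
      using ij wc by (intro eq A.finsum_closed) (auto simp: delta_def)
  next
    show "eps_relations n \<epsilon> A w"
      unfolding eps_relations_def
    proof (intro ballI conjI impI)
      fix i j k l assume r: "i \<in> {1..n}" "j \<in> {1..n}" "k \<in> {1..n}" "l \<in> {1..n}"
      have E: "eps_relations n \<epsilon> B v" using X by (simp add: X_relations_def)
      note E = E[unfolded eps_relations_def, rule_format, OF r]
      show "w i k \<otimes> w j l = w j l \<otimes> w i k" if "\<epsilon> i j = 1 \<and> \<epsilon> k l = 1"
        using E that r wc by (intro eq) (auto simp: \<phi>w)
      show "w i k \<otimes> w j l = \<zero>" if "\<epsilon> i j = 1 \<and> \<epsilon> k l = 0"
        using E that r wc by (intro eq) (auto simp: \<phi>w)
      show "w i k \<otimes> w j l = \<zero>" if "\<epsilon> i j = 0 \<and> \<epsilon> k l = 1"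
        using E that r wc by (intro eq) (auto simp: \<phi>w)
    qed
  qed
qed

lemma unital_star_hom_compose:
  assumes "f \<in> unital_star_hom A B" "g \<in> unital_star_hom B C"
  shows "(\<lambda>x. g (f x)) \<in> unital_star_hom A C"
  using assms by (auto simp: unital_star_hom_def ring_hom_def Pi_def)

text \<open>The matrix is pulled back to a copy of the subalgebra it generates, on the type where
  the universal property applies; the resulting map is composed with the embedding of the
  copy.\<close>

lemma universal_X_extend:
  assumes U: "universal_X n \<epsilon> A x" and B: "unital_cstar_algebra B" and X: "X_relations n \<epsilon> B y"
  shows "\<exists>\<phi>\<in>unital_star_hom A B. \<forall>i\<in>{1..n}. \<forall>j\<in>{1..n}. \<phi> (x i j) = y i j"
proof -
  have M: "matrix_over n B y" using X by (simp add: X_relations_def)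
  obtain C :: "(nat \<Rightarrow> nat) cstar" and \<psi> w
    where C: "cstar_hom C B \<psi>" "inj_on \<psi> (carrier C)" "matrix_over n C w"
      "\<forall>i\<in>{1..n}. \<forall>j\<in>{1..n}. \<psi> (w i j) = y i j"
    by (rule unital_cstar_algebra.matrix_copy[OF B M]) (rule that)
  have "unital_cstar_algebra C" "X_relations n \<epsilon> C w"
    using C(1) cstar_hom.X_relations_reflect[OF C(1-3), where v = y and \<epsilon> = \<epsilon>] C(4) X
    by (simp_all add: cstar_hom_def)
  then obtain \<phi> where \<phi>: "\<phi> \<in> unital_star_hom A C" "\<forall>i\<in>{1..n}. \<forall>j\<in>{1..n}. \<phi> (x i j) = w i j"
    using U unfolding universal_X_def by blast
  then show ?thesis
    using unital_star_hom_compose[OF \<phi>(1) cstar_hom.hom[OF C(1)]] C(4)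
    by (intro bexI[of _ "\<lambda>a. \<psi> (\<phi> a)"]) auto
qed

lemma universal_O_extend:
  assumes U: "universal_O n \<epsilon> A u" and B: "unital_cstar_algebra B" and O: "O_relations n \<epsilon> B v"
  shows "\<exists>\<phi>\<in>unital_star_hom A B. \<forall>i\<in>{1..n}. \<forall>j\<in>{1..n}. \<phi> (u i j) = v i j"
proof -
  have X: "X_relations n \<epsilon> B v" "X_relations n \<epsilon> B (\<lambda>i j. v j i)"
    using O by (auto simp: O_relations_iff)
  then have M: "matrix_over n B v" by (simp add: X_relations_def)
  obtain C :: "(nat \<Rightarrow> nat) cstar" and \<psi> w
    where C: "cstar_hom C B \<psi>" "inj_on \<psi> (carrier C)" "matrix_over n C w"
      "\<forall>i\<in>{1..n}. \<forall>j\<in>{1..n}. \<psi> (w i j) = v i j"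
    by (rule unital_cstar_algebra.matrix_copy[OF B M]) (rule that)
  have "matrix_over n C (\<lambda>i j. w j i)"
    using C(3) by (auto simp: matrix_over_def)
  then have "unital_cstar_algebra C" "O_relations n \<epsilon> C w"
    using C(1) cstar_hom.X_relations_reflect[OF C(1-3), where v = v and \<epsilon> = \<epsilon>]
      cstar_hom.X_relations_reflect[OF C(1,2), of n "\<lambda>i j. w j i" "\<lambda>i j. v j i" \<epsilon>]
      C(4) X by (simp_all add: cstar_hom_def O_relations_iff)
  then obtain \<phi> where \<phi>: "\<phi> \<in> unital_star_hom A C" "\<forall>i\<in>{1..n}. \<forall>j\<in>{1..n}. \<phi> (u i j) = w i j"
    using U unfolding universal_O_def by blast
  then show ?thesis
    using unital_star_hom_compose[OF \<phi>(1) cstar_hom.hom[OF C(1)]] C(4)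
    by (intro bexI[of _ "\<lambda>a. \<psi> (\<phi> a)"]) auto
qed

section \<open>The complex numbers as target of a character\<close>

definition complex_cstar :: "complex cstar" where
  "complex_cstar = \<lparr>carrier = UNIV, monoid.mult = (*), one = 1, ring.zero = 0, add = (+),
    smult = (*), star = cnj, cnorm = cmod\<rparr>"

lemma complex_cstar_simps [simp]:
  "carrier complex_cstar = UNIV" "a \<otimes>\<^bsub>complex_cstar\<^esub> b = a * b" "a \<oplus>\<^bsub>complex_cstar\<^esub> b = a + b"
  "\<one>\<^bsub>complex_cstar\<^esub> = 1" "\<zero>\<^bsub>complex_cstar\<^esub> = 0" "a \<odot>\<^bsub>complex_cstar\<^esub> b = a * b"
  "star complex_cstar a = cnj a" "cnorm complex_cstar a = cmod a"
  by (simp_all add: complex_cstar_def)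

lemma unital_cstar_algebra_complex: "unital_cstar_algebra complex_cstar"
proof -
  have ag: "abelian_group complex_cstar"
    by (rule abelian_groupI) (auto simp: algebra_simps intro: exI[of _ "- _"])
  have ring: "ring complex_cstar"
    by (rule ringI[OF ag]) (auto simp: algebra_simps intro!: monoidI)
  interpret ring complex_cstar by (rule ring)
  have minus: "a \<ominus>\<^bsub>complex_cstar\<^esub> b = a - b" for a b
    using minus_equality[of "- b" b] by (simp add: minus_eq)
  have mod: "module (ring_of_type_algebra :: complex ring) complex_cstar"
    by (rule moduleI[OF _ ag])
      (auto simp: cring_from_type_algebra ring_of_type_algebra_sel algebra_simps)
  show ?thesis
  proof (intro unital_cstar_algebra.intro[OF mod ring] unital_cstar_algebra_axioms.intro)
    fix s :: "nat \<Rightarrow> complex"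
    assume "\<And>e. e > 0 \<Longrightarrow> \<exists>N. \<forall>k\<ge>N. \<forall>l\<ge>N. cnorm complex_cstar (s k \<ominus>\<^bsub>complex_cstar\<^esub> s l) < e"
    then have "Cauchy s"
      by (simp add: minus Cauchy_def dist_norm)
    then obtain x where "s \<longlonglongrightarrow> x"
      using Cauchy_convergent_iff convergent_def by blast
    then show "\<exists>x\<in>carrier complex_cstar.
        (\<lambda>k. cnorm complex_cstar (s k \<ominus>\<^bsub>complex_cstar\<^esub> x)) \<longlonglongrightarrow> 0"
      using LIM_zero[THEN tendsto_norm_zero] by (auto simp: minus)
  qed (auto simp: algebra_simps norm_mult norm_triangle_ineq power2_eq_square)
qed

section \<open>Minimal tensor products and slices\<close>

definition unit_vec :: "'i \<Rightarrow> 'i \<Rightarrow> complex" where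
  "unit_vec i = (\<lambda>j. if j = i then 1 else 0)"

lemma finite_support_ell2: "finite {i. f i \<noteq> 0} \<Longrightarrow> f \<in> ell2"
  unfolding ell2_def by (auto intro!: finite_nonzero_values_imp_summable_on)

lemma unit_vec_ell2 [simp, intro]: "unit_vec i \<in> ell2"
  by (rule finite_support_ell2) (auto simp: unit_vec_def)

lemma zero_ell2 [simp, intro]: "(\<lambda>_. 0) \<in> ell2"
  by (rule finite_support_ell2) simp

lemma tensor_unit_vec: "tensor_vec (unit_vec i) (unit_vec j) = unit_vec (i, j)"
  by (auto simp: tensor_vec_def unit_vec_def fun_eq_iff)

lemma infsum_eq_single:
  fixes g :: "'i \<Rightarrow> complex"
  assumes "\<And>j. j \<noteq> i \<Longrightarrow> g j = 0" shows "(\<Sum>\<^sub>\<infinity>j. g j) = g i"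
proof -
  have "(\<Sum>\<^sub>\<infinity>j. g j) = infsum g {i}"
    using assms by (intro infsum_cong_neutral) auto
  then show ?thesis by simp
qed

lemma ell2_inner_unit_vec_left: "ell2_inner (unit_vec i) f = f i"
  unfolding ell2_inner_def by (subst infsum_eq_single[of i]) (auto simp: unit_vec_def)

lemma ell2_inner_unit_vec_right: "ell2_inner f (unit_vec i) = cnj (f i)"
  unfolding ell2_inner_def by (subst infsum_eq_single[of i]) (auto simp: unit_vec_def)

lemma ell2_norm_nonneg: "ell2_norm f \<ge> 0"
  by (simp add: ell2_norm_def infsum_nonneg)

lemma ell2_norm_eq_0D:
  assumes "f \<in> ell2" "ell2_norm f = 0" shows "f = (\<lambda>_. 0)"
proof
  fix i
  have "(cmod (f i))\<^sup>2 = 0"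
    using assms by (intro nonneg_infsum_le_0D[where A = UNIV and f = "\<lambda>i. (cmod (f i))\<^sup>2"])
      (auto simp: ell2_norm_def ell2_def)
  then show "f i = 0" by simp
qed

text \<open>Linearity handles the part of \<open>f\<close> on a finite index set; the rest has
  arbitrarily small norm, and boundedness carries this over to its image.\<close>

lemma bounded_operator_zeroI:
  assumes F: "bounded_operator F" and zero: "\<And>i. F (unit_vec i) = (\<lambda>_. 0)" and f: "f \<in> ell2"
  shows "F f = (\<lambda>_. 0)"
proof -
  have add: "\<And>g h. g \<in> ell2 \<Longrightarrow> h \<in> ell2 \<Longrightarrow> F (\<lambda>i. g i + h i) = (\<lambda>i. F g i + F h i)"
    and scale: "\<And>c g. g \<in> ell2 \<Longrightarrow> F (\<lambda>i. c * g i) = (\<lambda>i. c * F g i)"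
    and closed: "\<And>g. g \<in> ell2 \<Longrightarrow> F g \<in> ell2"
    using F by (auto simp: bounded_operator_def)
  obtain C where C: "\<And>g. g \<in> ell2 \<Longrightarrow> ell2_norm (F g) \<le> C * ell2_norm g"
    using F unfolding bounded_operator_def by blast
  have sq: "(\<lambda>i. (cmod (f i))\<^sup>2) summable_on I" for I
    using f summable_on_subset_banach[of "\<lambda>i. (cmod (f i))\<^sup>2" UNIV I] by (auto simp: ell2_def)
  have part: "(\<lambda>i. if i \<in> I then f i else 0) \<in> ell2" for I
  proof -
    have "(\<lambda>i. (cmod (if i \<in> I then f i else 0))\<^sup>2) summable_on UNIV
        \<longleftrightarrow> (\<lambda>i. (cmod (f i))\<^sup>2) summable_on I"
      by (rule summable_on_cong_neutral) auto
    then show ?thesis using sq by (simp add: ell2_def)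
  qed
  have fin: "F (\<lambda>i. if i \<in> I then f i else 0) = (\<lambda>_. 0)" if "finite I" for I
    using that
  proof (induction I rule: finite_induct)
    case empty
    then show ?case using scale[OF zero_ell2, of 0] by simp
  next
    case (insert k I)
    have "(\<lambda>i. if i \<in> insert k I then f i else 0)
        = (\<lambda>i. (if i \<in> I then f i else 0) + f k * unit_vec k i)"
      using insert by (auto simp: unit_vec_def fun_eq_iff)
    moreover have "(\<lambda>i. f k * unit_vec k i) \<in> ell2"
      by (rule finite_support_ell2) (auto simp: unit_vec_def)
    ultimately show ?case
      using insert by (simp add: add part scale zero)
  qed
  \<comment> \<open>The constant \<open>C\<close> comes without a sign, hence the absolute
    value.\<close>
  have bound: "ell2_norm (F f) \<le> \<bar>C\<bar> * sqrt e" if "e > 0" for e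
  proof -
    obtain I where I: "finite I" "dist (\<Sum>i\<in>I. (cmod (f i))\<^sup>2) (\<Sum>\<^sub>\<infinity>i. (cmod (f i))\<^sup>2) \<le> e"
      using infsum_finite_approximation[OF sq[of UNIV] \<open>e > 0\<close>] by auto
    let ?g = "\<lambda>i. if i \<in> - I then f i else 0"
    have "(\<Sum>\<^sub>\<infinity>i. (cmod (f i))\<^sup>2) = (\<Sum>i\<in>I. (cmod (f i))\<^sup>2) + (\<Sum>\<^sub>\<infinity>i\<in>-I. (cmod (f i))\<^sup>2)"
      using infsum_Un_disjoint[OF sq[of I] sq[of "- I"]] I(1) by simp
    moreover have "(\<Sum>\<^sub>\<infinity>i. (cmod (?g i))\<^sup>2) = (\<Sum>\<^sub>\<infinity>i\<in>-I. (cmod (f i))\<^sup>2)"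
      by (rule infsum_cong_neutral) auto
    ultimately have "ell2_norm ?g \<le> sqrt e"
      using I(2) by (simp add: ell2_norm_def dist_real_def)
    have "f = (\<lambda>i. (if i \<in> I then f i else 0) + ?g i)"
      by auto
    then have "F f = F (\<lambda>i. (if i \<in> I then f i else 0) + ?g i)"
      by simp
    also have "\<dots> = F ?g"
      unfolding add[OF part part] fin[OF I(1)] by simp
    finally have "ell2_norm (F f) \<le> C * ell2_norm ?g"
      using C[OF part[of "- I"]] by (simp only:)
    also have "\<dots> \<le> \<bar>C\<bar> * ell2_norm ?g"
      by (intro mult_right_mono ell2_norm_nonneg) auto
    also have "\<dots> \<le> \<bar>C\<bar> * sqrt e"
      using \<open>ell2_norm ?g \<le> sqrt e\<close> by (intro mult_left_mono) auto
    finally show ?thesis .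
  qed
  have "ell2_norm (F f) \<le> e" if "e > 0" for e
  proof -
    have pos: "\<bar>C\<bar> + 1 > 0" by simp
    \<comment> \<open>The summand 1 keeps the denominator positive when \<open>C\<close> is
      0.\<close>
    have "ell2_norm (F f) \<le> \<bar>C\<bar> * sqrt ((e / (\<bar>C\<bar> + 1))\<^sup>2)"
      using bound[of "(e / (\<bar>C\<bar> + 1))\<^sup>2"] that pos by simp
    also have "\<dots> = \<bar>C\<bar> / (\<bar>C\<bar> + 1) * e"
      using that by simp
    also have "\<dots> \<le> 1 * e"
      using that by (intro mult_right_mono) auto
    finally show ?thesis by simp
  qed
  then have "ell2_norm (F f) \<le> 0"
    by (rule field_le_epsilon) simp
  then show ?thesis
    using ell2_norm_nonneg[of "F f"] ell2_norm_eq_0D[OF closed[OF f]] by simp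
qed

lemma operator_norm_zero:
  assumes "\<And>f. f \<in> ell2 \<Longrightarrow> F f = (\<lambda>_. 0)" shows "operator_norm F = 0"
proof -
  have "ell2_norm (\<lambda>_. 0) = 0" by (simp add: ell2_norm_def)
  then have "(\<lambda>f. ell2_norm (F f)) ` {f \<in> ell2. ell2_norm f \<le> 1} = {0}"
    using assms by (auto intro!: image_eqI[of _ _ "\<lambda>_. 0"])
  then show ?thesis by (simp add: operator_norm_def)
qed

locale cstar_rep = unital_cstar_algebra A for A :: "'a cstar" (structure)
  and \<pi> :: "'a \<Rightarrow> ('i \<Rightarrow> complex) \<Rightarrow> 'i \<Rightarrow> complex" +
  assumes rep: "representation A \<pi>"
begin

lemma rep_bounded: "a \<in> carrier A \<Longrightarrow> bounded_operator (\<pi> a)"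
  and rep_add: "a \<in> carrier A \<Longrightarrow> b \<in> carrier A \<Longrightarrow> f \<in> ell2 \<Longrightarrow> \<pi> (a \<oplus> b) f = (\<lambda>i. \<pi> a f i + \<pi> b f i)"
  and rep_scale: "a \<in> carrier A \<Longrightarrow> f \<in> ell2 \<Longrightarrow> \<pi> (c \<odot> a) f = (\<lambda>i. c * \<pi> a f i)"
  and rep_mult: "a \<in> carrier A \<Longrightarrow> b \<in> carrier A \<Longrightarrow> f \<in> ell2 \<Longrightarrow> \<pi> (a \<otimes> b) f = \<pi> a (\<pi> b f)"
  and rep_adjoint: "a \<in> carrier A \<Longrightarrow> f \<in> ell2 \<Longrightarrow> g \<in> ell2 \<Longrightarrow>
    ell2_inner f (\<pi> (star A a) g) = ell2_inner (\<pi> a f) g"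
  using rep by (auto simp: representation_def)

lemma rep_ell2 [simp, intro]: "a \<in> carrier A \<Longrightarrow> f \<in> ell2 \<Longrightarrow> \<pi> a f \<in> ell2"
  using rep_bounded by (auto simp: bounded_operator_def)

lemma rep_zero: "f \<in> ell2 \<Longrightarrow> \<pi> \<zero> f = (\<lambda>_. 0)"
  using rep_scale[of \<zero> f 0] by simp

lemma rep_star_coeff:
  assumes "a \<in> carrier A" shows "\<pi> (star A a) (unit_vec i) k = cnj (\<pi> a (unit_vec k) i)"
  using rep_adjoint[OF assms unit_vec_ell2 unit_vec_ell2, of k i]
  by (simp add: ell2_inner_unit_vec_left ell2_inner_unit_vec_right)

lemma rep_diff_zero:
  assumes ab: "a \<in> carrier A" "b \<in> carrier A"
    and eq: "\<And>i. \<pi> a (unit_vec i) = \<pi> b (unit_vec i)" and f: "f \<in> ell2"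
  shows "\<pi> (a \<ominus> b) f = (\<lambda>_. 0)"
  using ab eq by (intro bounded_operator_zeroI[OF rep_bounded _ f])
    (auto simp: diff_eq_scale rep_add rep_scale)

text \<open>This and its isometric counterpart reduce equations in an algebra to computations on
  basis vectors.\<close>

lemma faithful_eqI:
  assumes "faithful_representation A \<pi>" "a \<in> carrier A" "b \<in> carrier A"
    "\<And>i. \<pi> a (unit_vec i) = \<pi> b (unit_vec i)"
  shows "a = b"
  using assms(1) rep_diff_zero[OF assms(2-4)] assms(2,3) diff_eq_zeroD[of a b]
  by (auto simp: faithful_representation_def)

lemma isometric_eqI:
  assumes "\<And>a. a \<in> carrier A \<Longrightarrow> cnorm A a = operator_norm (\<pi> a)" "a \<in> carrier A" "b \<in> carrier A"
    "\<And>i. \<pi> a (unit_vec i) = \<pi> b (unit_vec i)"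
  shows "a = b"
proof -
  have "cnorm A (a \<ominus> b) = 0"
    using assms(1)[of "a \<ominus> b"] assms(2,3) operator_norm_zero[OF rep_diff_zero[OF assms(2-4)]] by simp
  then show ?thesis
    using assms(2,3) cnorm_eq_0_iff[of "a \<ominus> b"] diff_eq_zeroD[of a b] by simp
qed

end

text \<open>Only the algebraic rules for elementary tensors are recorded, with no norm condition, so
  that exchanging the two legs gives another instance.\<close>

locale star_bimorphism = A: unital_cstar_algebra A + B: unital_cstar_algebra B +
  T: unital_cstar_algebra T
  for A :: "'a cstar" (structure) and B :: "'b cstar" (structure) and T :: "'t cstar" (structure)
    and tens :: "'a \<Rightarrow> 'b \<Rightarrow> 't" +
  assumes tens_closed [simp, intro]: "a \<in> carrier A \<Longrightarrow> b \<in> carrier B \<Longrightarrow> tens a b \<in> carrier T"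
    and tens_add_left: "a \<in> carrier A \<Longrightarrow> a' \<in> carrier A \<Longrightarrow> b \<in> carrier B \<Longrightarrow>
      tens (a \<oplus>\<^bsub>A\<^esub> a') b = tens a b \<oplus>\<^bsub>T\<^esub> tens a' b"
    and tens_add_right: "a \<in> carrier A \<Longrightarrow> b \<in> carrier B \<Longrightarrow> b' \<in> carrier B \<Longrightarrow>
      tens a (b \<oplus>\<^bsub>B\<^esub> b') = tens a b \<oplus>\<^bsub>T\<^esub> tens a b'"
    and tens_mult: "a \<in> carrier A \<Longrightarrow> a' \<in> carrier A \<Longrightarrow> b \<in> carrier B \<Longrightarrow> b' \<in> carrier B \<Longrightarrow>
      tens a b \<otimes>\<^bsub>T\<^esub> tens a' b' = tens (a \<otimes>\<^bsub>A\<^esub> a') (b \<otimes>\<^bsub>B\<^esub> b')"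
    and tens_star: "a \<in> carrier A \<Longrightarrow> b \<in> carrier B \<Longrightarrow>
      star T (tens a b) = tens (star A a) (star B b)"
    and tens_one: "tens \<one>\<^bsub>A\<^esub> \<one>\<^bsub>B\<^esub> = \<one>\<^bsub>T\<^esub>"

text \<open>This names the representations that \<open>min_tensor_product\<close> only asserts to
  exist, with free index types.\<close>

locale min_tensor = A: cstar_rep A \<pi> + B: cstar_rep B \<rho> + T: cstar_rep T \<sigma>
  for A :: "'a cstar" (structure) and \<pi> :: "'a \<Rightarrow> ('i \<Rightarrow> complex) \<Rightarrow> 'i \<Rightarrow> complex"
    and B :: "'b cstar" (structure) and \<rho> :: "'b \<Rightarrow> ('j \<Rightarrow> complex) \<Rightarrow> 'j \<Rightarrow> complex"
    and T :: "'t cstar" (structure) and \<sigma> :: "'t \<Rightarrow> ('i \<times> 'j \<Rightarrow> complex) \<Rightarrow> 'i \<times> 'j \<Rightarrow> complex"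
    and tens :: "'a \<Rightarrow> 'b \<Rightarrow> 't" +
  assumes faithful: "faithful_representation A \<pi>" "faithful_representation B \<rho>"
    and isometric: "t \<in> carrier T \<Longrightarrow> cnorm T t = operator_norm (\<sigma> t)"
    and tens_in_carrier: "a \<in> carrier A \<Longrightarrow> b \<in> carrier B \<Longrightarrow> tens a b \<in> carrier T"
    and dense: "lin_subspace T S \<Longrightarrow> norm_closed T S \<Longrightarrow>
      (\<And>a b. a \<in> carrier A \<Longrightarrow> b \<in> carrier B \<Longrightarrow> tens a b \<in> S) \<Longrightarrow> S = carrier T"
    and tens_tensor_vec: "a \<in> carrier A \<Longrightarrow> b \<in> carrier B \<Longrightarrow> f \<in> ell2 \<Longrightarrow> g \<in> ell2 \<Longrightarrow>
      \<sigma> (tens a b) (tensor_vec f g) = tensor_vec (\<pi> a f) (\<rho> b g)"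
begin

lemma tens_unit_vec:
  "a \<in> carrier A \<Longrightarrow> b \<in> carrier B \<Longrightarrow>
    \<sigma> (tens a b) (unit_vec (i, j)) = tensor_vec (\<pi> a (unit_vec i)) (\<rho> b (unit_vec j))"
  by (simp add: tens_tensor_vec flip: tensor_unit_vec)

lemma tensor_eqI:
  assumes "s \<in> carrier T" "t \<in> carrier T"
    "\<And>i j. \<sigma> s (unit_vec (i, j)) = \<sigma> t (unit_vec (i, j))"
  shows "s = t"
  using assms by (intro T.isometric_eqI[OF isometric]) auto

lemma star_bimorphism: "star_bimorphism A B T tens"
proof
  note [simp] = tens_in_carrier tens_unit_vec
  show mult: "tens a b \<otimes>\<^bsub>T\<^esub> tens a' b' = tens (a \<otimes>\<^bsub>A\<^esub> a') (b \<otimes>\<^bsub>B\<^esub> b')"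
    if "a \<in> carrier A" "a' \<in> carrier A" "b \<in> carrier B" "b' \<in> carrier B" for a a' b b'
    using that by (intro tensor_eqI) (auto simp: T.rep_mult A.rep_mult B.rep_mult tens_tensor_vec)
  show "tens (a \<oplus>\<^bsub>A\<^esub> a') b = tens a b \<oplus>\<^bsub>T\<^esub> tens a' b"
    if "a \<in> carrier A" "a' \<in> carrier A" "b \<in> carrier B" for a a' b
    using that by (intro tensor_eqI)
      (auto simp: T.rep_add A.rep_add tensor_vec_def fun_eq_iff algebra_simps)
  show "tens a (b \<oplus>\<^bsub>B\<^esub> b') = tens a b \<oplus>\<^bsub>T\<^esub> tens a b'"
    if "a \<in> carrier A" "b \<in> carrier B" "b' \<in> carrier B" for a b b'
    using that by (intro tensor_eqI)
      (auto simp: T.rep_add B.rep_add tensor_vec_def fun_eq_iff algebra_simps)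
  show "star T (tens a b) = tens (star A a) (star B b)"
    if "a \<in> carrier A" "b \<in> carrier B" for a b
    using that by (intro tensor_eqI)
      (auto simp: T.rep_star_coeff A.rep_star_coeff B.rep_star_coeff tensor_vec_def fun_eq_iff)
  let ?e = "tens \<one>\<^bsub>A\<^esub> \<one>\<^bsub>B\<^esub>"
  \<comment> \<open>The representations may be degenerate, so the unit of \<open>T\<close> cannot be
    read off on basis vectors. Instead, \<open>?e\<close> is a right identity for elementary
    tensors, hence for their closed span, which contains the unit.\<close>
  let ?S = "{t \<in> carrier T. t \<otimes>\<^bsub>T\<^esub> ?e = t}"
  have "norm_closed T ?S"
  proof (rule T.norm_closedI)
    fix s t assume s: "T.clim s t" "range s \<subseteq> ?S"
    then have "s k \<otimes>\<^bsub>T\<^esub> ?e = s k" for k by blast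
    then have "T.clim s (t \<otimes>\<^bsub>T\<^esub> ?e)"
      using T.clim_mult[OF s(1) T.clim_const, of ?e] by simp
    with s(1) have "t = t \<otimes>\<^bsub>T\<^esub> ?e"
      by (rule T.clim_unique)
    then show "t \<in> ?S"
      using T.climD(2)[OF s(1)] by simp
  qed auto
  then have "?S = carrier T"
    by (intro dense) (auto simp: lin_subspace_def T.l_distr T.smult_mult_left mult)
  then have "\<one>\<^bsub>T\<^esub> \<in> ?S" by simp
  then show "?e = \<one>\<^bsub>T\<^esub>" by simp
qed (rule tens_in_carrier)

end

lemma min_tensor_productE:
  fixes A :: "'a cstar" and B :: "'b cstar" and T :: "'t cstar"
  assumes "min_tensor_product A B T tens"
  obtains \<pi> :: "'a \<Rightarrow> ('a \<Rightarrow> complex) \<Rightarrow> 'a \<Rightarrow> complex"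
    and \<rho> :: "'b \<Rightarrow> ('b \<Rightarrow> complex) \<Rightarrow> 'b \<Rightarrow> complex"
    and \<sigma> :: "'t \<Rightarrow> ('a \<times> 'b \<Rightarrow> complex) \<Rightarrow> 'a \<times> 'b \<Rightarrow> complex"
  where "min_tensor A \<pi> B \<rho> T \<sigma> tens"
proof -
  obtain \<pi> :: "'a \<Rightarrow> ('a \<Rightarrow> complex) \<Rightarrow> 'a \<Rightarrow> complex"
    and \<rho> :: "'b \<Rightarrow> ('b \<Rightarrow> complex) \<Rightarrow> 'b \<Rightarrow> complex"
    and \<sigma> :: "'t \<Rightarrow> ('a \<times> 'b \<Rightarrow> complex) \<Rightarrow> 'a \<times> 'b \<Rightarrow> complex"
    where "unital_cstar_algebra A" "unital_cstar_algebra B" "unital_cstar_algebra T"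
      "\<forall>a\<in>carrier A. \<forall>b\<in>carrier B. tens a b \<in> carrier T"
      "\<forall>S. lin_subspace T S \<longrightarrow> norm_closed T S \<longrightarrow>
        (\<forall>a\<in>carrier A. \<forall>b\<in>carrier B. tens a b \<in> S) \<longrightarrow> S = carrier T"
      "faithful_representation A \<pi>" "faithful_representation B \<rho>" "representation T \<sigma>"
      "\<forall>t\<in>carrier T. cnorm T t = operator_norm (\<sigma> t)"
      "\<forall>a\<in>carrier A. \<forall>b\<in>carrier B. \<forall>f\<in>ell2. \<forall>g\<in>ell2.
           \<sigma> (tens a b) (tensor_vec f g) = tensor_vec (\<pi> a f) (\<rho> b g)"
    using assms unfolding min_tensor_product_def by (elim exE conjE) (rule that)
  moreover from this have "representation A \<pi>" "representation B \<rho>"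
    by (simp_all add: faithful_representation_def)
  ultimately have "min_tensor A \<pi> B \<rho> T \<sigma> tens"
    unfolding min_tensor_def min_tensor_axioms_def cstar_rep_def cstar_rep_axioms_def
    by (intro conjI allI impI) (simp_all only: simp_thms, blast+)
  then show ?thesis by (rule that)
qed

section \<open>Slicing the second leg with a character\<close>

locale slice_character = min_tensor A \<pi> B \<rho> T \<sigma> tens + X: cstar_hom B complex_cstar \<omega>
  for A :: "'a cstar" (structure) and \<pi> :: "'a \<Rightarrow> ('i \<Rightarrow> complex) \<Rightarrow> 'i \<Rightarrow> complex"
    and B :: "'b cstar" (structure) and \<rho> :: "'b \<Rightarrow> ('j \<Rightarrow> complex) \<Rightarrow> 'j \<Rightarrow> complex"
    and T :: "'t cstar" (structure) and \<sigma> :: "'t \<Rightarrow> ('i \<times> 'j \<Rightarrow> complex) \<Rightarrow> 'i \<times> 'j \<Rightarrow> complex"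
    and tens :: "'a \<Rightarrow> 'b \<Rightarrow> 't" and \<omega> :: "'b \<Rightarrow> complex"
begin

sublocale star_bimorphism A B T tens
  by (rule star_bimorphism)

text \<open>The graph of \<open>id \<otimes> \<omega>\<close> on the algebraic tensor product.\<close>

inductive slice :: "'t \<Rightarrow> 'a \<Rightarrow> bool" where
  slice_zero: "slice \<zero>\<^bsub>T\<^esub> \<zero>\<^bsub>A\<^esub>"
| slice_step: "slice t c \<Longrightarrow> a \<in> carrier A \<Longrightarrow> b \<in> carrier B \<Longrightarrow>
    slice (t \<oplus>\<^bsub>T\<^esub> tens a b) (c \<oplus>\<^bsub>A\<^esub> \<omega> b \<odot>\<^bsub>A\<^esub> a)"

lemma slice_closed: "slice t c \<Longrightarrow> t \<in> carrier T \<and> c \<in> carrier A"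
  by (induction rule: slice.induct) auto

lemma slice_add:
  assumes "slice s d" "slice t c" shows "slice (s \<oplus>\<^bsub>T\<^esub> t) (d \<oplus>\<^bsub>A\<^esub> c)"
  using assms(2)
proof (induction rule: slice.induct)
  case slice_zero
  then show ?case using assms(1) slice_closed[OF assms(1)] by simp
next
  case (slice_step t c a b)
  then show ?case
    using slice.slice_step[OF slice_step.IH slice_step.hyps(2,3)] slice_closed[OF assms(1)]
      slice_closed[OF slice_step.hyps(1)] by (simp add: T.a_assoc A.a_assoc)
qed

lemma slice_tens: "a \<in> carrier A \<Longrightarrow> b \<in> carrier B \<Longrightarrow> slice (tens a b) (\<omega> b \<odot>\<^bsub>A\<^esub> a)"
  using slice_step[OF slice_zero] by simp

lemma slice_one: "slice \<one>\<^bsub>T\<^esub> \<one>\<^bsub>A\<^esub>"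
  using slice_tens[of "\<one>\<^bsub>A\<^esub>" "\<one>\<^bsub>B\<^esub>"] X.hom_one by (simp add: tens_one)

text \<open>Multiplicativity of \<open>\<omega>\<close> enters here; slicing with a mere functional
  would not respect products.\<close>

lemma slice_mult_tens:
  assumes "slice t c" "a \<in> carrier A" "b \<in> carrier B"
  shows "slice (t \<otimes>\<^bsub>T\<^esub> tens a b) (c \<otimes>\<^bsub>A\<^esub> (\<omega> b \<odot>\<^bsub>A\<^esub> a))"
  using assms(1)
proof (induction rule: slice.induct)
  case slice_zero
  then show ?case using assms by (simp add: slice.slice_zero)
next
  case (slice_step t c a' b')
  have "slice (t \<otimes>\<^bsub>T\<^esub> tens a b \<oplus>\<^bsub>T\<^esub> tens (a' \<otimes>\<^bsub>A\<^esub> a) (b' \<otimes>\<^bsub>B\<^esub> b))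
      (c \<otimes>\<^bsub>A\<^esub> (\<omega> b \<odot>\<^bsub>A\<^esub> a) \<oplus>\<^bsub>A\<^esub> \<omega> (b' \<otimes>\<^bsub>B\<^esub> b) \<odot>\<^bsub>A\<^esub> (a' \<otimes>\<^bsub>A\<^esub> a))"
    using slice_step assms by (intro slice.slice_step) auto
  then show ?case
    using slice_step assms slice_closed[OF slice_step.hyps(1)] X.hom_mult[of b' b]
    by (simp add: T.l_distr A.l_distr tens_mult A.smult_mult_left A.smult_mult_right A.scale_scale
        A.scale_add_right mult.commute)
qed

lemma slice_mult:
  assumes "slice s d" "slice t c" shows "slice (s \<otimes>\<^bsub>T\<^esub> t) (d \<otimes>\<^bsub>A\<^esub> c)"
  using assms(2)
proof (induction rule: slice.induct)
  case slice_zero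
  then show ?case using slice_closed[OF assms(1)] by (simp add: slice.slice_zero)
next
  case (slice_step t c a b)
  then show ?case
    using slice_add[OF slice_step.IH slice_mult_tens[OF assms(1) slice_step.hyps(2,3)]]
      slice_closed[OF assms(1)] slice_closed[OF slice_step.hyps(1)]
    by (simp add: T.r_distr A.r_distr)
qed

lemma slice_star: "slice t c \<Longrightarrow> slice (star T t) (star A c)"
proof (induction rule: slice.induct)
  case slice_zero
  then show ?case by (simp add: slice.slice_zero)
next
  case (slice_step t c a b)
  then show ?case
    using slice.slice_step[OF slice_step.IH, of "star A a" "star B b"]
      slice_closed[OF slice_step.hyps(1)] X.hom_star[of b]
    by (simp add: T.star_add A.star_add tens_star A.star_smult)
qed

lemma slice_finsum:
  assumes "finite I" "\<And>i. i \<in> I \<Longrightarrow> slice (f i) (g i)"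
  shows "slice (finsum T f I) (finsum A g I)"
  using assms
proof (induction I rule: finite_induct)
  case empty
  then show ?case by (simp add: slice_zero)
next
  case (insert j J)
  have "f \<in> J \<rightarrow> carrier T" "g \<in> J \<rightarrow> carrier A" "f j \<in> carrier T" "g j \<in> carrier A"
    using insert slice_closed by auto
  then show ?case
    using insert slice_add by (simp add: T.finsum_insert A.finsum_insert)
qed

text \<open>Slices of different legs commute. Slicing the first leg by the matrix coefficient at i
  and k gives \<open>b\<close>; applying \<open>\<omega>\<close> to it agrees with slicing by
  \<open>\<omega>\<close> first and taking the coefficient of the result.\<close>

lemma slice_coefficient:
  assumes "slice t c"
  shows "\<exists>b\<in>carrier B. \<omega> b = \<pi> c (unit_vec i) k \<and>
    (\<forall>j l. \<sigma> t (unit_vec (i, j)) (k, l) = \<rho> b (unit_vec j) l)"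
  using assms
proof (induction rule: slice.induct)
  case slice_zero
  then show ?case
    using X.hom_zero by (intro bexI[of _ "\<zero>\<^bsub>B\<^esub>"]) (auto simp: A.rep_zero B.rep_zero T.rep_zero)
next
  case (slice_step t c a b)
  obtain b' where b': "b' \<in> carrier B" "\<omega> b' = \<pi> c (unit_vec i) k"
    "\<And>j l. \<sigma> t (unit_vec (i, j)) (k, l) = \<rho> b' (unit_vec j) l"
    using slice_step.IH by blast
  let ?b = "b' \<oplus>\<^bsub>B\<^esub> \<pi> a (unit_vec i) k \<odot>\<^bsub>B\<^esub> b"
  have "\<omega> ?b = \<pi> (c \<oplus>\<^bsub>A\<^esub> \<omega> b \<odot>\<^bsub>A\<^esub> a) (unit_vec i) k"
    using slice_step b' slice_closed[OF slice_step.hyps(1)] X.hom_add X.hom_scale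
    by (simp add: A.rep_add A.rep_scale)
  moreover have "\<sigma> (t \<oplus>\<^bsub>T\<^esub> tens a b) (unit_vec (i, j)) (k, l) = \<rho> ?b (unit_vec j) l" for j l
    using slice_step b' slice_closed[OF slice_step.hyps(1)]
    by (simp add: T.rep_add B.rep_add B.rep_scale tens_unit_vec tensor_vec_def)
  ultimately show ?case
    using slice_step b' by (intro bexI[of _ ?b]) auto
qed

text \<open>The element \<open>b\<close> of the preceding lemma depends only on \<open>t\<close>, by
  faithfulness of \<open>\<rho>\<close>. Hence \<open>c\<close> and \<open>d\<close> have the same
  matrix coefficients, and faithfulness of \<open>\<pi>\<close> identifies them.\<close>

lemma slice_unique:
  assumes "slice t c" "slice t d" shows "c = d"
proof (rule A.faithful_eqI[OF faithful(1)], goal_cases)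
  case (3 i)
  show ?case
  proof
    fix k
    obtain b where b: "b \<in> carrier B" "\<omega> b = \<pi> c (unit_vec i) k"
      "\<And>j l. \<sigma> t (unit_vec (i, j)) (k, l) = \<rho> b (unit_vec j) l"
      using slice_coefficient[OF assms(1)] by blast
    obtain b' where b': "b' \<in> carrier B" "\<omega> b' = \<pi> d (unit_vec i) k"
      "\<And>j l. \<sigma> t (unit_vec (i, j)) (k, l) = \<rho> b' (unit_vec j) l"
      using slice_coefficient[OF assms(2)] by blast
    have "b = b'"
    proof (rule B.faithful_eqI[OF faithful(2) b(1) b'(1)])
      show "\<rho> b (unit_vec j) = \<rho> b' (unit_vec j)" for j
        using b(3)[of j] b'(3)[of j] by (intro ext) simp
    qed
    then show "\<pi> c (unit_vec i) k = \<pi> d (unit_vec i) k"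
      using b(2) b'(2) by simp
  qed
qed (use slice_closed assms in auto)

end

section \<open>Quantum symmetries\<close>

lemma min_tensor_product_star_bimorphism:
  "min_tensor_product A B T tens \<Longrightarrow> star_bimorphism A B T tens"
  by (erule min_tensor_productE) (rule min_tensor.star_bimorphism)

lemma (in star_bimorphism) flip: "star_bimorphism B A T (\<lambda>b a. tens a b)"
  by unfold_locales (auto simp: tens_add_left tens_add_right tens_mult tens_star tens_one)

section \<open>Products of matrices across the two legs\<close>

context star_bimorphism
begin

lemma tens_zero_left [simp]: "b \<in> carrier B \<Longrightarrow> tens \<zero>\<^bsub>A\<^esub> b = \<zero>\<^bsub>T\<^esub>"
  using tens_add_left[of "\<zero>\<^bsub>A\<^esub>" "\<zero>\<^bsub>A\<^esub>" b] by simp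

lemma tens_zero_right [simp]: "a \<in> carrier A \<Longrightarrow> tens a \<zero>\<^bsub>B\<^esub> = \<zero>\<^bsub>T\<^esub>"
  using tens_add_right[of a "\<zero>\<^bsub>B\<^esub>" "\<zero>\<^bsub>B\<^esub>"] by simp

lemma tens_finsum_left:
  assumes "finite I" "\<And>i. i \<in> I \<Longrightarrow> f i \<in> carrier A" "b \<in> carrier B"
  shows "tens (finsum A f I) b = (\<Oplus>\<^bsub>T\<^esub>i\<in>I. tens (f i) b)"
  using assms
proof (induction I rule: finite_induct)
  case (insert j J)
  then have "f \<in> J \<rightarrow> carrier A" by auto
  with insert show ?case by (auto simp: A.finsum_insert T.finsum_insert tens_add_left Pi_def)
qed simp

lemma tens_finsum_right:
  assumes "finite I" "\<And>i. i \<in> I \<Longrightarrow> f i \<in> carrier B" "a \<in> carrier A"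
  shows "tens a (finsum B f I) = (\<Oplus>\<^bsub>T\<^esub>i\<in>I. tens a (f i))"
  using assms
proof (induction I rule: finite_induct)
  case (insert j J)
  then have "f \<in> J \<rightarrow> carrier B" by auto
  with insert show ?case by (auto simp: B.finsum_insert T.finsum_insert tens_add_right Pi_def)
qed simp

text \<open>Stated for any two matrices with these relations, so that it covers the
  comultiplication, its transpose with the legs exchanged, and both actions.\<close>

lemma X_relations_tensor_product:
  assumes \<epsilon>: "\<forall>i\<in>{1..n}. \<forall>j\<in>{1..n}. \<epsilon> i j \<in> {0, 1}"
    and sym: "\<forall>i\<in>{1..n}. \<forall>j\<in>{1..n}. \<epsilon> i j = \<epsilon> j i"
    and U: "X_relations n \<epsilon> A U" and X: "X_relations n \<epsilon> B x"
  shows "X_relations n \<epsilon> T (\<lambda>i k. \<Oplus>\<^bsub>T\<^esub>j\<in>{1..n}. tens (U i j) (x j k))"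
proof -
  let ?I = "{1..n}"
  define y where "y i k = (\<Oplus>\<^bsub>T\<^esub>j\<in>?I. tens (U i j) (x j k))" for i k
  have Uc [simp]: "U i j \<in> carrier A" and xc [simp]: "x i j \<in> carrier B"
    and Us: "star A (U i j) = U i j" and xs: "star B (x i j) = x i j"
    if "i \<in> ?I" "j \<in> ?I" for i j
    using U X that by (auto simp: X_relations_def matrix_over_def)
  have yc: "y i k \<in> carrier T" if "i \<in> ?I" "k \<in> ?I" for i k
    unfolding y_def using that by (intro T.finsum_closed) auto
  have prod: "y i k \<otimes>\<^bsub>T\<^esub> y j l =
      (\<Oplus>\<^bsub>T\<^esub>p\<in>?I. \<Oplus>\<^bsub>T\<^esub>q\<in>?I. tens (U i p \<otimes>\<^bsub>A\<^esub> U j q) (x p k \<otimes>\<^bsub>B\<^esub> x q l))"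
    if r: "i \<in> ?I" "j \<in> ?I" "k \<in> ?I" "l \<in> ?I" for i j k l
  proof -
    have "y i k \<otimes>\<^bsub>T\<^esub> y j l = (\<Oplus>\<^bsub>T\<^esub>p\<in>?I. tens (U i p) (x p k) \<otimes>\<^bsub>T\<^esub> y j l)"
      unfolding y_def[of i k] using r yc[of j l] by (intro T.finsum_ldistr) auto
    also have "\<dots> = (\<Oplus>\<^bsub>T\<^esub>p\<in>?I. \<Oplus>\<^bsub>T\<^esub>q\<in>?I. tens (U i p \<otimes>\<^bsub>A\<^esub> U j q) (x p k \<otimes>\<^bsub>B\<^esub> x q l))"
    proof (intro T.finsum_cong' refl)
      fix p assume p: "p \<in> ?I"
      have "tens (U i p) (x p k) \<otimes>\<^bsub>T\<^esub> y j l
          = (\<Oplus>\<^bsub>T\<^esub>q\<in>?I. tens (U i p) (x p k) \<otimes>\<^bsub>T\<^esub> tens (U j q) (x q l))"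
        unfolding y_def using r p by (intro T.finsum_rdistr) auto
      also have "\<dots> = (\<Oplus>\<^bsub>T\<^esub>q\<in>?I. tens (U i p \<otimes>\<^bsub>A\<^esub> U j q) (x p k \<otimes>\<^bsub>B\<^esub> x q l))"
        using r p by (intro T.finsum_cong') (auto simp: tens_mult)
      finally show "tens (U i p) (x p k) \<otimes>\<^bsub>T\<^esub> y j l
          = (\<Oplus>\<^bsub>T\<^esub>q\<in>?I. tens (U i p \<otimes>\<^bsub>A\<^esub> U j q) (x p k \<otimes>\<^bsub>B\<^esub> x q l))" .
    qed (use r in \<open>auto intro!: T.finsum_closed\<close>)
    finally show ?thesis .
  qed
  have Urel: "eps_relations n \<epsilon> A U" and xrel: "eps_relations n \<epsilon> B x"
    using U X by (auto simp: X_relations_def)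
  note Urel = Urel[unfolded eps_relations_def, rule_format]
  note xrel = xrel[unfolded eps_relations_def, rule_format]
  have zero: "y i k \<otimes>\<^bsub>T\<^esub> y j l = \<zero>\<^bsub>T\<^esub>"
    if r: "i \<in> ?I" "j \<in> ?I" "k \<in> ?I" "l \<in> ?I" and ne: "\<epsilon> i j \<noteq> \<epsilon> k l" for i j k l
  proof -
    have "tens (U i p \<otimes>\<^bsub>A\<^esub> U j q) (x p k \<otimes>\<^bsub>B\<^esub> x q l) = \<zero>\<^bsub>T\<^esub>" if pq: "p \<in> ?I" "q \<in> ?I" for p q
    proof -
      \<comment> \<open>The values at (i, j) and (k, l) differ, so the value at (p, q) differs from
        one of them, and the corresponding leg is zero.\<close>
      have "\<epsilon> i j \<in> {0, 1}" "\<epsilon> k l \<in> {0, 1}" "\<epsilon> p q \<in> {0, 1}"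
        using \<epsilon> r pq by auto
      then consider "\<epsilon> i j = 1 \<and> \<epsilon> p q = 0 \<or> \<epsilon> i j = 0 \<and> \<epsilon> p q = 1"
        | "\<epsilon> p q = 1 \<and> \<epsilon> k l = 0 \<or> \<epsilon> p q = 0 \<and> \<epsilon> k l = 1"
        using ne by auto
      then show ?thesis
      proof cases
        case 1
        then have "U i p \<otimes>\<^bsub>A\<^esub> U j q = \<zero>\<^bsub>A\<^esub>" using Urel[OF r(1,2) pq] by blast
        then show ?thesis using r pq by simp
      next
        case 2
        then have "x p k \<otimes>\<^bsub>B\<^esub> x q l = \<zero>\<^bsub>B\<^esub>" using xrel[OF pq r(3,4)] by blast
        then show ?thesis using r pq by simp
      qed
    qed
    then have "y i k \<otimes>\<^bsub>T\<^esub> y j l = (\<Oplus>\<^bsub>T\<^esub>p\<in>?I. \<Oplus>\<^bsub>T\<^esub>q\<in>?I. \<zero>\<^bsub>T\<^esub>)"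
      unfolding prod[OF r] by (intro T.finsum_cong') auto
    then show ?thesis by (simp add: T.finsum_zero)
  qed
  have comm: "y i k \<otimes>\<^bsub>T\<^esub> y j l = y j l \<otimes>\<^bsub>T\<^esub> y i k"
    if r: "i \<in> ?I" "j \<in> ?I" "k \<in> ?I" "l \<in> ?I" and one: "\<epsilon> i j = 1" "\<epsilon> k l = 1" for i j k l
  proof -
    \<comment> \<open>If the value at (p, q) is 1, both legs commute; if it is 0, the first leg
      vanishes in either order. The reversed order is where symmetry of \<open>\<epsilon>\<close> is
      used.\<close>
    have eq: "tens (U i p \<otimes>\<^bsub>A\<^esub> U j q) (x p k \<otimes>\<^bsub>B\<^esub> x q l)
        = tens (U j q \<otimes>\<^bsub>A\<^esub> U i p) (x q l \<otimes>\<^bsub>B\<^esub> x p k)" if pq: "p \<in> ?I" "q \<in> ?I" for p q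
    proof -
      have "\<epsilon> j i = 1" "\<epsilon> q p = \<epsilon> p q" using sym r one pq by auto
      moreover have "\<epsilon> p q = 0 \<or> \<epsilon> p q = 1" using \<epsilon> pq by auto
      ultimately show ?thesis
        using Urel[OF r(1,2) pq] Urel[OF r(2,1) pq(2,1)] xrel[OF pq r(3,4)] one r pq by auto
    qed
    have "y i k \<otimes>\<^bsub>T\<^esub> y j l
        = (\<Oplus>\<^bsub>T\<^esub>p\<in>?I. \<Oplus>\<^bsub>T\<^esub>q\<in>?I. tens (U j q \<otimes>\<^bsub>A\<^esub> U i p) (x q l \<otimes>\<^bsub>B\<^esub> x p k))"
      unfolding prod[OF r] using r eq by (intro T.finsum_cong' refl) (auto intro!: T.finsum_closed)
    also have "\<dots> = (\<Oplus>\<^bsub>T\<^esub>q\<in>?I. \<Oplus>\<^bsub>T\<^esub>p\<in>?I. tens (U j q \<otimes>\<^bsub>A\<^esub> U i p) (x q l \<otimes>\<^bsub>B\<^esub> x p k))"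
      using r by (intro T.finsum_commute) auto
    finally show ?thesis
      unfolding prod[OF r(2,1,4,3)] .
  qed
  have orth: "(\<Oplus>\<^bsub>T\<^esub>i\<in>?I. y i k \<otimes>\<^bsub>T\<^esub> y i l) = delta T k l" if r: "k \<in> ?I" "l \<in> ?I" for k l
  proof -
    \<comment> \<open>Summing over i first lets orthogonality of the columns of \<open>U\<close>
      collapse the double sum over p and q to its diagonal.\<close>
    have inner: "(\<Oplus>\<^bsub>T\<^esub>i\<in>?I. tens (U i p \<otimes>\<^bsub>A\<^esub> U i q) (x p k \<otimes>\<^bsub>B\<^esub> x q l))
        = (if p = q then tens \<one>\<^bsub>A\<^esub> (x q k \<otimes>\<^bsub>B\<^esub> x q l) else \<zero>\<^bsub>T\<^esub>)" if pq: "p \<in> ?I" "q \<in> ?I" for p q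
    proof -
      have "(\<Oplus>\<^bsub>T\<^esub>i\<in>?I. tens (U i p \<otimes>\<^bsub>A\<^esub> U i q) (x p k \<otimes>\<^bsub>B\<^esub> x q l))
          = tens (\<Oplus>\<^bsub>A\<^esub>i\<in>?I. U i p \<otimes>\<^bsub>A\<^esub> U i q) (x p k \<otimes>\<^bsub>B\<^esub> x q l)"
        using r pq by (intro tens_finsum_left[symmetric]) auto
      also have "(\<Oplus>\<^bsub>A\<^esub>i\<in>?I. U i p \<otimes>\<^bsub>A\<^esub> U i q) = delta A p q"
        using U pq by (simp add: X_relations_def)
      finally show ?thesis
        using r pq by (simp add: delta_def)
    qed
    have "(\<Oplus>\<^bsub>T\<^esub>i\<in>?I. y i k \<otimes>\<^bsub>T\<^esub> y i l) = (\<Oplus>\<^bsub>T\<^esub>i\<in>?I. \<Oplus>\<^bsub>T\<^esub>p\<in>?I. \<Oplus>\<^bsub>T\<^esub>q\<in>?I.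
        tens (U i p \<otimes>\<^bsub>A\<^esub> U i q) (x p k \<otimes>\<^bsub>B\<^esub> x q l))"
      using r by (intro T.finsum_cong') (auto simp: prod intro!: T.finsum_closed)
    also have "\<dots> = (\<Oplus>\<^bsub>T\<^esub>p\<in>?I. \<Oplus>\<^bsub>T\<^esub>i\<in>?I. \<Oplus>\<^bsub>T\<^esub>q\<in>?I.
        tens (U i p \<otimes>\<^bsub>A\<^esub> U i q) (x p k \<otimes>\<^bsub>B\<^esub> x q l))"
      using r by (intro T.finsum_commute) (auto intro!: T.finsum_closed)
    also have "\<dots> = (\<Oplus>\<^bsub>T\<^esub>p\<in>?I. tens \<one>\<^bsub>A\<^esub> (x p k \<otimes>\<^bsub>B\<^esub> x p l))"
    proof (intro T.finsum_cong' refl)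
      fix p assume p: "p \<in> ?I"
      have "(\<Oplus>\<^bsub>T\<^esub>i\<in>?I. \<Oplus>\<^bsub>T\<^esub>q\<in>?I. tens (U i p \<otimes>\<^bsub>A\<^esub> U i q) (x p k \<otimes>\<^bsub>B\<^esub> x q l))
          = (\<Oplus>\<^bsub>T\<^esub>q\<in>?I. \<Oplus>\<^bsub>T\<^esub>i\<in>?I. tens (U i p \<otimes>\<^bsub>A\<^esub> U i q) (x p k \<otimes>\<^bsub>B\<^esub> x q l))"
        using r p by (intro T.finsum_commute) auto
      also have "\<dots> = (\<Oplus>\<^bsub>T\<^esub>q\<in>?I. if p = q then tens \<one>\<^bsub>A\<^esub> (x q k \<otimes>\<^bsub>B\<^esub> x q l) else \<zero>\<^bsub>T\<^esub>)"
        using r p by (intro T.finsum_cong'[OF refl _ inner[OF p]]) auto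
      also have "\<dots> = tens \<one>\<^bsub>A\<^esub> (x p k \<otimes>\<^bsub>B\<^esub> x p l)"
        using r p by (intro T.finsum_singleton) auto
      finally show "(\<Oplus>\<^bsub>T\<^esub>i\<in>?I. \<Oplus>\<^bsub>T\<^esub>q\<in>?I. tens (U i p \<otimes>\<^bsub>A\<^esub> U i q) (x p k \<otimes>\<^bsub>B\<^esub> x q l))
          = tens \<one>\<^bsub>A\<^esub> (x p k \<otimes>\<^bsub>B\<^esub> x p l)" .
    qed (use r in auto)
    also have "\<dots> = tens \<one>\<^bsub>A\<^esub> (\<Oplus>\<^bsub>B\<^esub>p\<in>?I. x p k \<otimes>\<^bsub>B\<^esub> x p l)"
      using r by (intro tens_finsum_right[symmetric]) auto
    also have "(\<Oplus>\<^bsub>B\<^esub>p\<in>?I. x p k \<otimes>\<^bsub>B\<^esub> x p l) = delta B k l"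
      using X r by (simp add: X_relations_def)
    finally show ?thesis
      by (simp add: delta_def tens_one)
  qed
  have star: "star T (y i k) = y i k" if r: "i \<in> ?I" "k \<in> ?I" for i k
  proof -
    have "star T (y i k) = (\<Oplus>\<^bsub>T\<^esub>j\<in>?I. star T (tens (U i j) (x j k)))"
      unfolding y_def using r by (intro T.star_finsum) auto
    also have "\<dots> = y i k"
      unfolding y_def using r by (intro T.finsum_cong') (auto simp: tens_star Us xs)
    finally show ?thesis .
  qed
  have "X_relations n \<epsilon> T y"
    unfolding X_relations_def eps_relations_def matrix_over_def
    by (intro conjI ballI impI; (rule yc star orth comm zero; (assumption | simp)))
  then show ?thesis
    by (simp add: y_def[abs_def])
qed

end

section \<open>The character at the identity matrix and the relations forced by an action\<close>

lemma finsum_complex_cstar: "finite I \<Longrightarrow> finsum complex_cstar f I = sum f I"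
proof (induction I rule: finite_induct)
  case empty
  interpret unital_cstar_algebra complex_cstar by (rule unital_cstar_algebra_complex)
  show ?case using finsum_empty[of f] by simp
next
  case (insert j J)
  interpret unital_cstar_algebra complex_cstar by (rule unital_cstar_algebra_complex)
  show ?case using finsum_insert[of J j f] insert by simp
qed

text \<open>A product of the entries at (i, k) and (j, l) is nonzero only for i = k and j = l. Then
  both values of \<open>\<epsilon>\<close> coincide and no vanishing condition applies.\<close>

lemma X_relations_identity_matrix:
  "X_relations n \<epsilon> complex_cstar (\<lambda>i j. if i = j then 1 else 0)"
proof -
  have "(\<Sum>i\<in>{1..n}. (if i = k then 1 else 0) * (if i = l then 1 else 0)) = (if k = l then 1 else 0 :: complex)"
    if "k \<in> {1..n}" for k l
  proof -
    have "(\<Sum>i\<in>{1..n}. (if i = k then 1 else 0) * (if i = l then 1 else 0))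
        = (\<Sum>i\<in>{1..n}. if i = k then (if k = l then 1 else 0 :: complex) else 0)"
      by (intro sum.cong) auto
    then show ?thesis using that by simp
  qed
  then show ?thesis
    by (auto simp: X_relations_def matrix_over_def eps_relations_def finsum_complex_cstar delta_def)
qed

text \<open>The slice by the character \<open>x \<mapsto> (identity matrix)\<close> sends \<open>\<alpha> (x i k)\<close> to \<open>v i k\<close>, so
  every relation between the \<open>x i k\<close> passes to the \<open>v i k\<close>.\<close>

lemma X_relations_of_action:
  fixes A :: "'a cstar" and B :: "'b cstar" and T :: "'t cstar"
  assumes T: "min_tensor_product A B T tens" and X: "universal_X n \<epsilon> B x"
    and \<alpha>: "\<alpha> \<in> unital_star_hom B T"
      "\<forall>i\<in>{1..n}. \<forall>k\<in>{1..n}. \<alpha> (x i k) = (\<Oplus>\<^bsub>T\<^esub>j\<in>{1..n}. tens (v i j) (x j k))"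
    and v: "matrix_over n A v"
  shows "X_relations n \<epsilon> A v"
proof -
  obtain \<pi> :: "'a \<Rightarrow> ('a \<Rightarrow> complex) \<Rightarrow> 'a \<Rightarrow> complex"
    and \<rho> :: "'b \<Rightarrow> ('b \<Rightarrow> complex) \<Rightarrow> 'b \<Rightarrow> complex"
    and \<sigma> where mt: "min_tensor A \<pi> B \<rho> T \<sigma> tens"
    by (rule min_tensor_productE[OF T])
  obtain \<omega> where \<omega>: "\<omega> \<in> unital_star_hom B complex_cstar"
    "\<forall>i\<in>{1..n}. \<forall>j\<in>{1..n}. \<omega> (x i j) = (if i = j then 1 else 0)"
    using universal_X_extend[OF X unital_cstar_algebra_complex X_relations_identity_matrix] by blast
  interpret M: min_tensor A \<pi> B \<rho> T \<sigma> tens by (rule mt)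
  interpret slice_character A \<pi> B \<rho> T \<sigma> tens \<omega>
    by (intro slice_character.intro mt cstar_hom.intro cstar_hom_axioms.intro \<omega>(1)
        M.B.unital_cstar_algebra_axioms unital_cstar_algebra_complex)
  interpret \<alpha>: cstar_hom B T \<alpha>
    by (intro cstar_hom.intro cstar_hom_axioms.intro \<alpha>(1) M.B.unital_cstar_algebra_axioms
        M.T.unital_cstar_algebra_axioms)
  let ?I = "{1..n}"
  have XB: "X_relations n \<epsilon> B x" using X by (simp add: universal_X_def)
  have xc [simp]: "x i j \<in> carrier B" and vc [simp]: "v i j \<in> carrier A"
    if "i \<in> ?I" "j \<in> ?I" for i j
    using XB v that by (auto simp: X_relations_def matrix_over_def)
  have slice: "slice (\<alpha> (x i k)) (v i k)" if r: "i \<in> ?I" "k \<in> ?I" for i k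
  proof -
    have "slice (\<Oplus>\<^bsub>T\<^esub>j\<in>?I. tens (v i j) (x j k)) (\<Oplus>\<^bsub>A\<^esub>j\<in>?I. \<omega> (x j k) \<odot>\<^bsub>A\<^esub> v i j)"
      using r by (intro slice_finsum slice_tens) auto
    moreover have "(\<Oplus>\<^bsub>A\<^esub>j\<in>?I. \<omega> (x j k) \<odot>\<^bsub>A\<^esub> v i j) = (\<Oplus>\<^bsub>A\<^esub>j\<in>?I. if k = j then v i j else \<zero>\<^bsub>A\<^esub>)"
      using r \<omega>(2) by (intro M.A.finsum_cong') auto
    moreover have "\<dots> = v i k"
      using r by (intro M.A.finsum_singleton) auto
    ultimately show ?thesis using \<alpha>(2) r by simp
  qed
  show ?thesis
    unfolding X_relations_def
  proof (intro conjI ballI v)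
    fix i k assume r: "i \<in> ?I" "k \<in> ?I"
    have "star B (x i k) = x i k" using XB r by (simp add: X_relations_def)
    then have "star T (\<alpha> (x i k)) = \<alpha> (x i k)"
      using r \<alpha>.hom_star[of "x i k"] by simp
    then show "star A (v i k) = v i k"
      using slice_unique[OF slice_star[OF slice[OF r]]] slice[OF r] by simp
  next
    fix k l assume r: "k \<in> ?I" "l \<in> ?I"
    have "\<alpha> (\<Oplus>\<^bsub>B\<^esub>i\<in>?I. x i k \<otimes>\<^bsub>B\<^esub> x i l) = (\<Oplus>\<^bsub>T\<^esub>i\<in>?I. \<alpha> (x i k \<otimes>\<^bsub>B\<^esub> x i l))"
      using r by (intro \<alpha>.hom_finsum) auto
    also have "(\<Oplus>\<^bsub>B\<^esub>i\<in>?I. x i k \<otimes>\<^bsub>B\<^esub> x i l) = delta B k l"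
      using XB r by (simp add: X_relations_def)
    also have "\<alpha> (delta B k l) = delta T k l"
      by (simp add: delta_def)
    \<comment> \<open>The same element of \<open>T\<close> is sliced termwise here and directly
      below; uniqueness equates the two results.\<close>
    finally have "slice (delta T k l) (\<Oplus>\<^bsub>A\<^esub>i\<in>?I. v i k \<otimes>\<^bsub>A\<^esub> v i l)"
      using r slice_finsum[of ?I "\<lambda>i. \<alpha> (x i k \<otimes>\<^bsub>B\<^esub> x i l)" "\<lambda>i. v i k \<otimes>\<^bsub>A\<^esub> v i l"]
        slice_mult[OF slice slice] by simp
    moreover have "slice (delta T k l) (delta A k l)"
      by (simp add: delta_def slice_one slice_zero)
    ultimately show "(\<Oplus>\<^bsub>A\<^esub>i\<in>?I. v i k \<otimes>\<^bsub>A\<^esub> v i l) = delta A k l"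
      by (rule slice_unique)
  next
    show "eps_relations n \<epsilon> A v"
      unfolding eps_relations_def
    proof (intro ballI conjI impI)
      fix i j k l assume r: "i \<in> ?I" "j \<in> ?I" "k \<in> ?I" "l \<in> ?I"
      have "eps_relations n \<epsilon> B x" using XB by (simp add: X_relations_def)
      note E = this[unfolded eps_relations_def, rule_format, OF r]
      have S: "slice (\<alpha> (x i k \<otimes>\<^bsub>B\<^esub> x j l)) (v i k \<otimes>\<^bsub>A\<^esub> v j l)"
        "slice (\<alpha> (x j l \<otimes>\<^bsub>B\<^esub> x i k)) (v j l \<otimes>\<^bsub>A\<^esub> v i k)"
        using r slice_mult[OF slice slice] by simp_all
      have Z: "slice (\<alpha> \<zero>\<^bsub>B\<^esub>) \<zero>\<^bsub>A\<^esub>"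
        by (simp add: slice_zero)
      show "v i k \<otimes>\<^bsub>A\<^esub> v j l = v j l \<otimes>\<^bsub>A\<^esub> v i k" if "\<epsilon> i j = 1 \<and> \<epsilon> k l = 1"
        using E that slice_unique[OF S(1)] S(2) by metis
      show "v i k \<otimes>\<^bsub>A\<^esub> v j l = \<zero>\<^bsub>A\<^esub>" if "\<epsilon> i j = 1 \<and> \<epsilon> k l = 0"
        using E that slice_unique[OF S(1)] Z by metis
      show "v i k \<otimes>\<^bsub>A\<^esub> v j l = \<zero>\<^bsub>A\<^esub>" if "\<epsilon> i j = 0 \<and> \<epsilon> k l = 1"
        using E that slice_unique[OF S(1)] Z by metis
    qed
  qed
qed

section \<open>The quantum group, its actions and its maximality\<close>

lemma O_compact_matrix_quantum_group:
  assumes \<epsilon>: "\<forall>i\<in>{1..n}. \<forall>j\<in>{1..n}. \<epsilon> i j \<in> {0, 1}"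
    and sym: "\<forall>i\<in>{1..n}. \<forall>j\<in>{1..n}. \<epsilon> i j = \<epsilon> j i"
    and U: "universal_O n \<epsilon> A u" and T: "min_tensor_product A A T tens"
  shows "compact_matrix_quantum_group n A u T tens"
proof -
  have A: "unital_cstar_algebra A" and rel: "O_relations n \<epsilon> A u" and gen: "cstar_generates A (entries n u)"
    using U by (simp_all add: universal_O_def)
  interpret unital_cstar_algebra A by (rule A)
  have uc: "matrix_over n A u" "\<forall>i\<in>{1..n}. \<forall>j\<in>{1..n}. star A (u i j) = u i j"
    using rel by (simp_all add: O_relations_def)
  have inv: "matrix_invertible n A u"
    using rel unfolding matrix_invertible_def O_relations_def
    by (intro exI[of _ "\<lambda>i j. u j i"]) (auto simp: matrix_over_def)
  have inv': "matrix_invertible n A (\<lambda>i j. star A (u i j))"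
  proof -
    obtain v where v: "matrix_over n A v" "\<forall>i\<in>{1..n}. \<forall>j\<in>{1..n}.
        (\<Oplus>\<^bsub>A\<^esub>k\<in>{1..n}. u i k \<otimes>\<^bsub>A\<^esub> v k j) = delta A i j \<and>
        (\<Oplus>\<^bsub>A\<^esub>k\<in>{1..n}. v i k \<otimes>\<^bsub>A\<^esub> u k j) = delta A i j"
      using inv unfolding matrix_invertible_def by blast
    have "(\<Oplus>\<^bsub>A\<^esub>k\<in>{1..n}. star A (u i k) \<otimes>\<^bsub>A\<^esub> v k j) = (\<Oplus>\<^bsub>A\<^esub>k\<in>{1..n}. u i k \<otimes>\<^bsub>A\<^esub> v k j)"
      "(\<Oplus>\<^bsub>A\<^esub>k\<in>{1..n}. v i k \<otimes>\<^bsub>A\<^esub> star A (u k j)) = (\<Oplus>\<^bsub>A\<^esub>k\<in>{1..n}. v i k \<otimes>\<^bsub>A\<^esub> u k j)"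
      if "i \<in> {1..n}" "j \<in> {1..n}" for i j
      using uc v(1) that by (auto intro!: finsum_cong' simp: matrix_over_def)
    then show ?thesis
      unfolding matrix_invertible_def using v by (intro exI[of _ v]) simp
  qed
  interpret T: star_bimorphism A A T tens
    by (rule min_tensor_product_star_bimorphism[OF T])
  \<comment> \<open>Transposing the matrix of the comultiplication exchanges the legs, so the
    transposed relations come from the flipped pairing applied to transposed matrices.\<close>
  interpret F: star_bimorphism A A T "\<lambda>b a. tens a b"
    by (rule T.flip)
  have X: "X_relations n \<epsilon> A u" "X_relations n \<epsilon> A (\<lambda>i j. u j i)"
    using rel by (auto simp: O_relations_iff)
  have "O_relations n \<epsilon> T (\<lambda>i j. \<Oplus>\<^bsub>T\<^esub>k\<in>{1..n}. tens (u i k) (u k j))"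
    using T.X_relations_tensor_product[OF \<epsilon> sym X(1) X(1)]
      F.X_relations_tensor_product[OF \<epsilon> sym X(2) X(2)]
    by (simp add: O_relations_iff)
  from universal_O_extend[OF U T.T.unital_cstar_algebra_axioms this] show ?thesis
    unfolding compact_matrix_quantum_group_def
    using A T uc gen inv inv' by blast
qed

text \<open>Both \<open>u\<close> and its transpose satisfy the relations of \<open>x\<close>, so
  one product lemma provides the target matrices of \<alpha> and \<beta>.\<close>

lemma acts_by_tensor_product:
  assumes \<epsilon>: "\<forall>i\<in>{1..n}. \<forall>j\<in>{1..n}. \<epsilon> i j \<in> {0, 1}"
    and sym: "\<forall>i\<in>{1..n}. \<forall>j\<in>{1..n}. \<epsilon> i j = \<epsilon> j i"
    and u: "O_relations n \<epsilon> A u" and X: "universal_X n \<epsilon> B x" and T: "min_tensor_product A B T tens"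
  shows "acts_by n A u B x T tens"
proof -
  interpret T: star_bimorphism A B T tens
    by (rule min_tensor_product_star_bimorphism[OF T])
  have XB: "X_relations n \<epsilon> B x" using X by (simp add: universal_X_def)
  have X': "X_relations n \<epsilon> A u" "X_relations n \<epsilon> A (\<lambda>i j. u j i)"
    using u by (auto simp: O_relations_iff)
  note ext = universal_X_extend[OF X T.T.unital_cstar_algebra_axioms]
  show ?thesis
    unfolding acts_by_def
    using ext[OF T.X_relations_tensor_product[OF \<epsilon> sym X'(1) XB]]
      ext[OF T.X_relations_tensor_product[OF \<epsilon> sym X'(2) XB]] by blast
qed

lemma quantum_subgroup_of_action:
  assumes U: "universal_O n \<epsilon> CO u" and O: "compact_matrix_quantum_group n CO u TO tO"
    and X: "universal_X n \<epsilon> CX x"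
    and G: "compact_matrix_quantum_group n CG v TG tG"
    and T: "min_tensor_product CG CX TX tX" and act: "acts_by n CG v CX x TX tX"
  shows "quantum_subgroup n CG v TG tG CO u TO tO"
proof -
  have CG: "unital_cstar_algebra CG" "matrix_over n CG v" "cstar_generates CG (entries n v)"
    using G by (simp_all add: compact_matrix_quantum_group_def)
  have vt: "matrix_over n CG (\<lambda>i j. v j i)"
    using CG(2) by (auto simp: matrix_over_def)
  obtain \<alpha> \<beta> where "\<alpha> \<in> unital_star_hom CX TX"
      "\<forall>i\<in>{1..n}. \<forall>k\<in>{1..n}. \<alpha> (x i k) = (\<Oplus>\<^bsub>TX\<^esub>j\<in>{1..n}. tX (v i j) (x j k))"
    and "\<beta> \<in> unital_star_hom CX TX"
      "\<forall>i\<in>{1..n}. \<forall>k\<in>{1..n}. \<beta> (x i k) = (\<Oplus>\<^bsub>TX\<^esub>j\<in>{1..n}. tX (v j i) (x j k))"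
    using act unfolding acts_by_def by blast
  \<comment> \<open>The map \<beta> has the form of \<alpha> for the transposed matrix, so the slice
    argument applies to it unchanged.\<close>
  then have "O_relations n \<epsilon> CG v"
    using X_relations_of_action[OF T X _ _ CG(2)] X_relations_of_action[OF T X _ _ vt]
    by (auto simp: O_relations_iff)
  then obtain \<phi> where \<phi>: "\<phi> \<in> unital_star_hom CO CG" "\<forall>i\<in>{1..n}. \<forall>j\<in>{1..n}. \<phi> (u i j) = v i j"
    using universal_O_extend[OF U CG(1)] by blast
  interpret cstar_hom CO CG \<phi>
    using U by (intro cstar_hom.intro cstar_hom_axioms.intro \<phi>(1) CG(1)) (simp add: universal_O_def)
  have "entries n v \<subseteq> \<phi> ` carrier CO"
  proof
    fix a assume "a \<in> entries n v"
    then obtain i j where ij: "i \<in> {1..n}" "j \<in> {1..n}" "a = v i j"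
      by (auto simp: entries_def)
    then have "u i j \<in> carrier CO"
      using U by (simp add: universal_O_def O_relations_def matrix_over_def)
    then show "a \<in> \<phi> ` carrier CO"
      using \<phi>(2) ij by (intro image_eqI[of _ _ "u i j"]) auto
  qed
  then have "\<phi> ` carrier CO = carrier CG"
    by (rule image_eq_carrier[OF CG(3)])
  then show ?thesis
    unfolding quantum_subgroup_def using G O \<phi> by blast
qed

theorem theorem6:
  fixes n :: nat and \<epsilon> :: "nat \<Rightarrow> nat \<Rightarrow> nat"
    and CO :: "'o cstar" and u :: "nat \<Rightarrow> nat \<Rightarrow> 'o"
    and CX :: "'x cstar" and x :: "nat \<Rightarrow> nat \<Rightarrow> 'x"
    and TOO :: "'oo cstar" and tOO :: "'o \<Rightarrow> 'o \<Rightarrow> 'oo"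
    and TOX :: "'ox cstar" and tOX :: "'o \<Rightarrow> 'x \<Rightarrow> 'ox"
  assumes "n \<ge> 1"
    and "\<forall>i\<in>{1..n}. \<forall>j\<in>{1..n}. \<epsilon> i j \<in> {0, 1}"
    and "\<forall>i\<in>{1..n}. \<forall>j\<in>{1..n}. \<epsilon> i j = \<epsilon> j i"
    and "\<forall>i\<in>{1..n}. \<epsilon> i i = 0"
    and "universal_O n \<epsilon> CO u"
    and "universal_X n \<epsilon> CX x"
    and "min_tensor_product CO CO TOO tOO"
    and "min_tensor_product CO CX TOX tOX"
  shows "compact_matrix_quantum_group n CO u TOO tOO \<and>
    acts_by n CO u CX x TOX tOX \<and>
    (\<forall>(CG :: 'g cstar) v (TGG :: 'gg cstar) tGG (TGX :: 'gx cstar) tGX.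
      compact_matrix_quantum_group n CG v TGG tGG \<and>
      min_tensor_product CG CX TGX tGX \<and>
      acts_by n CG v CX x TGX tGX \<longrightarrow>
      quantum_subgroup n CG v TGG tGG CO u TOO tOO)"
proof (intro conjI allI impI)
  show O: "compact_matrix_quantum_group n CO u TOO tOO"
    by (rule O_compact_matrix_quantum_group[OF assms(2,3,5,7)])
  show "acts_by n CO u CX x TOX tOX"
    using assms(5) by (intro acts_by_tensor_product[OF assms(2,3) _ assms(6,8)]) (simp add: universal_O_def)
  fix CG :: "'g cstar" and v and TGG :: "'gg cstar" and tGG and TGX :: "'gx cstar" and tGX
  assume "compact_matrix_quantum_group n CG v TGG tGG \<and> min_tensor_product CG CX TGX tGX \<and>
    acts_by n CG v CX x TGX tGX"
  then show "quantum_subgroup n CG v TGG tGG CO u TOO tOO"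
    using quantum_subgroup_of_action[OF assms(5) O assms(6)] by blast
qed

end
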